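(* Let $n,k\in\mathbb{N}$ with $n\ge 3$, and let $G$ be the graph obtained from the complete graph on $n$ vertices by subdividing every edge with $k$ newly introduced vertices (that is, replacing every edge by a path of length $k+1$). Then $\mathrm{tw}(G)=n-1$, $\ell(G)=3(k+1)$, and the connected tree-width of $G$ is precisely $$\mathrm{ctw}(G)=(n-1)(k+1)-\left\lfloor\frac{k+1}{2}\right\rfloor .$$
   Context: Graphs are finite, simple and undirected. A tree-decomposition of $G$ is a pair $(T,(V_t)_{t\in T})$ of a tree $T$ and vertex sets (parts) $V_t\subseteq V(G)$, one for each node $t$ of $T$, such that: $V(G)=\bigcup_{t}V_t$; every edge of $G$ has both ends in some $V_t$; and $V_{t_1}\cap V_{t_3}\subseteq V_{t_2}$ whenever $t_2$ lies on the path in $T$ from $t_1$ to $t_3$. Its width is $\max_t(|V_t|-1)$, and the tree-width $\mathrm{tw}(G)$ is the minimum width of a tree-decomposition of $G$. A tree-decomposition is called connected if each part $V_t$ induces a connected subgraph of $G$, and the connected tree-width $\mathrm{ctw}(G)$ is the minimum width of a connected tree-decomposition of $G$. $\ell(G)$ denotes the smallest natural number $\ell$ such that the cycles of $G$ of length at most $\ell$ generate the cycle space of $G$ (over $\mathbb{F}_2$). *)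

theory Defs
  imports Complex_Main "HOL-Library.Z2" "HOL-Library.Function_Algebras"
    "HOL-Library.Indicator_Function"
begin

section \<open>Finite simple graphs\<close>

record 'a sgraph =
  verts :: "'a set"
  edges :: "'a set set"

definition simple_graph :: "'a sgraph \<Rightarrow> bool" where
  "simple_graph G \<longleftrightarrow> finite (verts G) \<and>
     (\<forall>e\<in>edges G. \<exists>u\<in>verts G. \<exists>v\<in>verts G. u \<noteq> v \<and> e = {u, v})"

definition induced_subgraph :: "'a sgraph \<Rightarrow> 'a set \<Rightarrow> 'a sgraph" where
  "induced_subgraph G U = \<lparr> verts = verts G \<inter> U, edges = {e \<in> edges G. e \<subseteq> U} \<rparr>"

text \<open>Paths and cycles are given by their lists of vertices. In a cycle the vertices are
  pairwise distinct and the first one is not repeated at the end, so the length of a cycle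
  (its number of edges) is the length of the list.\<close>

definition path_edges :: "'a list \<Rightarrow> 'a set set" where
  "path_edges p = {{p ! i, p ! Suc i} |i. Suc i < length p}"

definition cycle_edges :: "'a list \<Rightarrow> 'a set set" where
  "cycle_edges c = insert {last c, hd c} (path_edges c)"

definition is_path :: "'a sgraph \<Rightarrow> 'a list \<Rightarrow> bool" where
  "is_path G p \<longleftrightarrow> p \<noteq> [] \<and> distinct p \<and> set p \<subseteq> verts G \<and> path_edges p \<subseteq> edges G"

definition is_cycle :: "'a sgraph \<Rightarrow> 'a list \<Rightarrow> bool" where
  "is_cycle G c \<longleftrightarrow> 3 \<le> length c \<and> distinct c \<and> set c \<subseteq> verts G \<and> cycle_edges c \<subseteq> edges G"

definition connected_graph :: "'a sgraph \<Rightarrow> bool" where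
  "connected_graph G \<longleftrightarrow> verts G \<noteq> {} \<and>
     (\<forall>u\<in>verts G. \<forall>v\<in>verts G. \<exists>p. is_path G p \<and> hd p = u \<and> last p = v)"

definition tree :: "'a sgraph \<Rightarrow> bool" where
  "tree T \<longleftrightarrow> simple_graph T \<and> connected_graph T \<and> (\<nexists>c. is_cycle T c)"


section \<open>Tree-width and connected tree-width\<close>

definition tree_decomposition :: "'a sgraph \<Rightarrow> 't sgraph \<Rightarrow> ('t \<Rightarrow> 'a set) \<Rightarrow> bool" where
  "tree_decomposition G T V \<longleftrightarrow> tree T \<and>
     verts G = (\<Union>t\<in>verts T. V t) \<and>
     (\<forall>e\<in>edges G. \<exists>t\<in>verts T. e \<subseteq> V t) \<and>
     (\<forall>p t1 t2 t3. is_path T p \<and> hd p = t1 \<and> last p = t3 \<and> t2 \<in> set p \<longrightarrow> V t1 \<inter> V t3 \<subseteq> V t2)"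

definition connected_tree_decomposition ::
    "'a sgraph \<Rightarrow> 't sgraph \<Rightarrow> ('t \<Rightarrow> 'a set) \<Rightarrow> bool" where
  "connected_tree_decomposition G T V \<longleftrightarrow> tree_decomposition G T V \<and>
     (\<forall>t\<in>verts T. connected_graph (induced_subgraph G (V t)))"

text \<open>Subtraction on \<^typ>\<open>nat\<close> is truncated, so an empty part contributes \<open>0\<close> instead of
  \<open>-1\<close>. This changes the width only if all parts, and hence the graph, are empty.\<close>

definition width :: "'t sgraph \<Rightarrow> ('t \<Rightarrow> 'a set) \<Rightarrow> nat" where
  "width T V = Max ((\<lambda>t. card (V t) - 1) ` verts T)"

text \<open>Trees are finite, so up to isomorphism it suffices to consider trees whose nodes are
  natural numbers. The decomposition with a single part shows that the first minimum exists
  for every finite graph and the second one for every connected finite graph.\<close>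

definition tree_width :: "'a sgraph \<Rightarrow> nat" where
  "tree_width G =
     (LEAST w. \<exists>(T :: nat sgraph) V. tree_decomposition G T V \<and> width T V = w)"

definition connected_tree_width :: "'a sgraph \<Rightarrow> nat" where
  "connected_tree_width G =
     (LEAST w. \<exists>(T :: nat sgraph) V. connected_tree_decomposition G T V \<and> width T V = w)"


section \<open>The cycle space\<close>

text \<open>Edge sets are identified with their characteristic functions, taking values in the
  field \<^typ>\<open>bit\<close> of two elements; addition is then symmetric difference.\<close>

definition edge_scale :: "bit \<Rightarrow> ('a set \<Rightarrow> bit) \<Rightarrow> 'a set \<Rightarrow> bit" where
  "edge_scale a f = (\<lambda>e. a * f e)"

interpretation edge_space: vector_space edge_scale
  by unfold_locales (auto simp: edge_scale_def fun_eq_iff algebra_simps)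

definition cycle_space :: "'a sgraph \<Rightarrow> ('a set \<Rightarrow> bit) set" where
  "cycle_space G = edge_space.span {indicator (cycle_edges c) |c. is_cycle G c}"

definition short_cycles_generate :: "'a sgraph \<Rightarrow> nat \<Rightarrow> bool" where
  "short_cycles_generate G l \<longleftrightarrow>
     edge_space.span {indicator (cycle_edges c) |c. is_cycle G c \<and> length c \<le> l} = cycle_space G"

definition ell :: "'a sgraph \<Rightarrow> nat" where
  "ell G = (LEAST l. short_cycles_generate G l)"


section \<open>Complete graphs and their subdivisions\<close>

definition complete_graph :: "'a sgraph \<Rightarrow> bool" where
  "complete_graph K \<longleftrightarrow> finite (verts K) \<and>
     edges K = {{u, v} |u v. u \<in> verts K \<and> v \<in> verts K \<and> u \<noteq> v}"

definition inner_verts :: "'a list \<Rightarrow> 'a set" where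
  "inner_verts p = set (butlast (tl p))"

text \<open>\<open>G\<close> arises from \<open>H\<close> by replacing each edge \<open>e\<close> with a path \<open>P e\<close> of length \<open>k + 1\<close>
  between the ends of \<open>e\<close>, whose \<open>k\<close> inner vertices are new and lie on no other of these paths.\<close>

definition subdivision_by :: "nat \<Rightarrow> 'a sgraph \<Rightarrow> 'a sgraph \<Rightarrow> bool" where
  "subdivision_by k H G \<longleftrightarrow> (\<exists>P.
     (\<forall>e\<in>edges H. length (P e) = k + 2 \<and> distinct (P e) \<and> {hd (P e), last (P e)} = e \<and>
        inner_verts (P e) \<inter> verts H = {}) \<and>
     (\<forall>e\<in>edges H. \<forall>f\<in>edges H. e \<noteq> f \<longrightarrow> inner_verts (P e) \<inter> inner_verts (P f) = {}) \<and>
     verts G = verts H \<union> (\<Union>e\<in>edges H. inner_verts (P e)) \<and>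
     edges G = (\<Union>e\<in>edges H. path_edges (P e)))"

end

theory Submission
  imports Defs
begin

text \<open>
  Write \<open>m = k + 1\<close> for the length of the subdivided edges, and call the vertices of the complete
  graph the branch vertices. All three equations are proved in the locale \<open>subdivided_clique\<close>, in
  which the graph is given by the branch vertices and by parametrizations of the subdivided edges.

  Tree-width: the complete graph is a minor of \<open>G\<close>, and its branch sets are \<open>n\<close> disjoint connected
  sets that touch pairwise. Some part of every tree-decomposition meets all members of such a
  family (\<open>bramble_cover\<close>), which follows from the Helly property of subtrees of a tree. Conversely,
  to a part consisting of all branch vertices one can attach a path of parts of size at most three for
  each subdivided edge.

  Cycle space: an edge set with all degrees even contains each subdivided edge entirely or not at
  all, so it behaves like an even edge set of the complete graph. Hence it has at least \<open>3 * m\<close>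
  edges unless it is empty, and it is a sum of subdivided triangles through a fixed branch vertex
  (\<open>even_deg_in_span\<close>). The cycles of length at most \<open>3 * m\<close> therefore generate, and there are no
  shorter cycles at all.

  Connected tree-width, upper bound: two stars with different centres and with the other \<open>n - 2\<close>
  branch vertices as leaves, extended until they meet in the middle of the subdivided edge between
  the centres, separate the remaining subdivided edges from each other
  (\<open>connected_decomposition\<close>).

  Connected tree-width, lower bound: a connected set \<open>X\<close> with at most \<open>(n - 1) * m - m div 2\<close> vertices
  misses a branch vertex, and all branch vertices outside \<open>X\<close> lie in one component of \<open>G - X\<close> if
  \<open>X\<close> contains a branch vertex. The pieces of these components given by \<open>free_part\<close> form a bramble,
  because two sets whose pieces do not touch are too large together (\<open>free_parts_touch\<close>): each of
  them contains a spanning tree of its branch vertices, and together they block all subdivided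
  edges between the branch vertices outside the one and those outside the other. A part of a
  connected tree-decomposition of smaller width could not meet all members of this bramble.
\<close>

section \<open>Paths and connectedness\<close>

lemma path_edges_Nil [simp]: "path_edges [] = {}"
  by (simp add: path_edges_def)

lemma path_edges_single [simp]: "path_edges [x] = {}"
  by (simp add: path_edges_def)

lemma path_edges_Cons [simp]:
  "path_edges (x # y # xs) = insert {x, y} (path_edges (y # xs))"
proof -
  have *: "path_edges p = (\<lambda>i. {p ! i, p ! Suc i}) ` {..<length p - 1}" for p :: "'a list"
    by (auto simp: path_edges_def)
  have "{..<length (x # y # xs) - 1} = insert 0 (Suc ` {..<length (y # xs) - 1})"
    by (simp add: lessThan_Suc_eq_insert_0)
  then show ?thesis unfolding * by (simp add: image_image)
qed

lemma path_edges_append: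
  assumes "xs \<noteq> []" "ys \<noteq> []"
  shows "path_edges (xs @ ys) = insert {last xs, hd ys} (path_edges xs \<union> path_edges ys)"
  using assms
proof (induction xs)
  case (Cons x xs)
  show ?case
  proof (cases xs)
    case Nil
    then show ?thesis using Cons.prems by (cases ys) auto
  next
    case (Cons z zs)
    then show ?thesis using Cons.IH Cons.prems by auto
  qed
qed simp

lemma path_edges_rev [simp]: "path_edges (rev xs) = path_edges xs"
proof (induction xs)
  case (Cons x xs)
  show ?case
  proof (cases xs)
    case (Cons y ys)
    then have "path_edges (rev xs @ [x]) = insert {last (rev xs), x} (path_edges (rev xs))"
      by (subst path_edges_append) auto
    then show ?thesis using Cons.IH Cons by (auto simp: insert_commute)
  qed simp
qed simp

lemma path_edges_subset_set: "e \<in> path_edges p \<Longrightarrow> e \<subseteq> set p"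
  by (auto simp: path_edges_def)

lemma is_path_rev: "is_path H p \<Longrightarrow> is_path H (rev p)"
  by (simp add: is_path_def)

lemma is_path_prefix: "is_path H (xs @ ys) \<Longrightarrow> xs \<noteq> [] \<Longrightarrow> is_path H xs"
  by (cases "ys = []") (auto simp: is_path_def path_edges_append)

lemma is_path_suffix: "is_path H (xs @ ys) \<Longrightarrow> ys \<noteq> [] \<Longrightarrow> is_path H ys"
  by (cases "xs = []") (auto simp: is_path_def path_edges_append)

lemma is_path_join:
  assumes "is_path H (xs @ [z])" "is_path H (z # ys)" "set xs \<inter> set ys = {}"
  shows "is_path H (xs @ z # ys)"
  using assms by (cases "xs = []"; cases "ys = []")
    (auto simp: is_path_def path_edges_append)

definition adj_in :: "'a sgraph \<Rightarrow> 'a set \<Rightarrow> ('a \<times> 'a) set" where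
  "adj_in H U = {(x, y). x \<in> U \<and> y \<in> U \<and> {x, y} \<in> edges H}"

lemma sym_adj_in: "sym (adj_in H U)"
  by (auto simp: sym_def adj_in_def insert_commute)

lemma adj_in_rtrancl_sym: "(x, y) \<in> (adj_in H U)\<^sup>* \<Longrightarrow> (y, x) \<in> (adj_in H U)\<^sup>*"
  using sym_rtrancl[OF sym_adj_in] by (meson symD)

lemma path_adj_in_rtrancl:
  "set p \<subseteq> U \<Longrightarrow> path_edges p \<subseteq> edges H \<Longrightarrow> p \<noteq> [] \<Longrightarrow> (hd p, last p) \<in> (adj_in H U)\<^sup>*"
proof (induction p rule: induct_list012)
  case (3 x y zs)
  then have "(x, y) \<in> adj_in H U" "(y, last (y # zs)) \<in> (adj_in H U)\<^sup>*"
    by (auto simp: adj_in_def)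
  then show ?case by auto
qed auto

lemma adj_in_rtrancl_path:
  assumes "(x, y) \<in> (adj_in H U)\<^sup>*" "x \<in> verts H \<inter> U" "U \<subseteq> verts H"
  shows "\<exists>p. is_path (induced_subgraph H U) p \<and> hd p = x \<and> last p = y"
  using assms(1)
proof (induction rule: rtrancl_induct)
  case base
  then show ?case using assms
    by (intro exI[of _ "[x]"]) (auto simp: is_path_def induced_subgraph_def)
next
  case (step y z)
  then obtain p where p: "is_path (induced_subgraph H U) p" "hd p = x" "last p = y" by auto
  have ne: "p \<noteq> []" using p by (auto simp: is_path_def)
  show ?case
  proof (cases "z \<in> set p")
    case True
    then obtain as bs where "p = (as @ [z]) @ bs" by (auto simp: in_set_conv_decomp)
    then show ?thesis using is_path_prefix[of _ "as @ [z]" bs] p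
      by (intro exI[of _ "as @ [z]"]) (cases as; auto)
  next
    case False
    have "{y, z} \<in> edges (induced_subgraph H U)" "z \<in> verts (induced_subgraph H U)"
      using step(2) assms(3) by (auto simp: adj_in_def induced_subgraph_def)
    then have "is_path (induced_subgraph H U) (p @ [z])"
      using p ne False by (auto simp: is_path_def path_edges_append)
    then show ?thesis using p ne by (intro exI[of _ "p @ [z]"]) auto
  qed
qed

text \<open>A walk can be shortened to a path, so connectedness may be checked with walks, that is, with
  the reflexive transitive closure of adjacency; no distinctness has to be maintained.\<close>

lemma connected_induced_iff:
  assumes "U \<subseteq> verts H"
  shows "connected_graph (induced_subgraph H U) \<longleftrightarrow>
     U \<noteq> {} \<and> (\<forall>x\<in>U. \<forall>y\<in>U. (x, y) \<in> (adj_in H U)\<^sup>*)"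
proof -
  have v: "verts (induced_subgraph H U) = U" using assms by (auto simp: induced_subgraph_def)
  have 1: "(x, y) \<in> (adj_in H U)\<^sup>*"
    if "is_path (induced_subgraph H U) p" "hd p = x" "last p = y" for x y p
    using that path_adj_in_rtrancl[of p U H] by (auto simp: is_path_def induced_subgraph_def)
  have 2: "\<exists>p. is_path (induced_subgraph H U) p \<and> hd p = x \<and> last p = y"
    if "(x, y) \<in> (adj_in H U)\<^sup>*" "x \<in> U" for x y
    using adj_in_rtrancl_path[OF that(1) _ assms] that(2) assms by auto
  show ?thesis
    unfolding connected_graph_def v using 1 2 by blast
qed

lemma connected_via_root:
  assumes "r \<in> U" "U \<subseteq> verts H" "\<And>x. x \<in> U \<Longrightarrow> (r, x) \<in> (adj_in H U)\<^sup>*"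
  shows "connected_graph (induced_subgraph H U)"
  unfolding connected_induced_iff[OF assms(2)]
  using assms adj_in_rtrancl_sym by (metis empty_iff rtrancl_trans)

text \<open>What a connected set \<open>U\<close> looks like is always derived in this form: if \<open>U\<close> meets both \<open>A\<close> and
  its complement, then some edge inside \<open>U\<close> leaves \<open>A\<close>, and for a well-chosen \<open>A\<close> the edges leaving
  \<open>A\<close> are few and known.\<close>

lemma connected_cut:
  assumes "connected_graph (induced_subgraph H U)" "U \<subseteq> verts H"
    and "x \<in> U" "x \<in> A" "y \<in> U" "y \<notin> A"
  shows "\<exists>a b. a \<in> U \<and> a \<in> A \<and> b \<in> U \<and> b \<notin> A \<and> {a, b} \<in> edges H"
proof (rule ccontr)
  assume c: "\<not> ?thesis"
  have "(x, y) \<in> (adj_in H U)\<^sup>*" using assms by (simp add: connected_induced_iff)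
  then have "y \<in> A"
    by (induction rule: rtrancl_induct) (use c assms in \<open>auto simp: adj_in_def\<close>)
  then show False using assms by simp
qed


section \<open>A bag that meets every member of a bramble\<close>

text \<open>The node \<open>z\<close> is the first node of \<open>p\<close> on a path from \<open>c\<close> to an end of \<open>p\<close>. It plays the role of
  the median of \<open>c\<close> and the two ends of \<open>p\<close>.\<close>

lemma path_meeting_node:
  assumes con: "connected_graph T" and p: "is_path T p" and c: "c \<in> verts T"
  obtains p1 z p2 s where "p = p1 @ z # p2" "is_path T (p1 @ z # s)" "is_path T (rev p2 @ z # s)"
    "last (z # s) = c"
proof -
  have ne: "p \<noteq> []" and "hd p \<in> verts T" using p by (auto simp: is_path_def)
  then obtain r where r: "is_path T r" "hd r = c" "last r = hd p"
    using con c by (auto simp: connected_graph_def)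
  then have "last r \<in> set r" using last_in_set unfolding is_path_def by blast
  then have "\<exists>x\<in>set r. x \<in> set p" using ne r(3) hd_in_set by metis
  then obtain r1 z r2 where rr: "r = r1 @ z # r2" "z \<in> set p" "\<forall>y\<in>set r1. y \<notin> set p"
    using split_list_first_prop[of r "\<lambda>x. x \<in> set p"] by metis
  then obtain p1 p2 where pp: "p = p1 @ z # p2" by (metis split_list)
  have "is_path T (r1 @ [z])" using is_path_prefix[of T "r1 @ [z]" r2] r rr by auto
  then have s: "is_path T (z # rev r1)" using is_path_rev by fastforce
  have a: "is_path T (p1 @ [z])" using is_path_prefix[of T "p1 @ [z]" p2] p pp by auto
  have "is_path T (z # p2)" using is_path_suffix[of T p1 "z # p2"] p pp by auto
  then have b: "is_path T (rev p2 @ [z])" using is_path_rev by fastforce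
  have "is_path T (p1 @ z # rev r1)" by (rule is_path_join[OF a s]) (use rr pp in auto)
  moreover have "is_path T (rev p2 @ z # rev r1)" by (rule is_path_join[OF b s]) (use rr pp in auto)
  moreover have "last (z # rev r1) = c" using r rr by (cases r1) auto
  ultimately show ?thesis using that pp by blast
qed

text \<open>In a tree, the nonempty sets of this kind are the node sets of subtrees.\<close>

definition path_convex :: "'t sgraph \<Rightarrow> 't set \<Rightarrow> bool" where
  "path_convex T S \<longleftrightarrow> S \<subseteq> verts T \<and>
     (\<forall>p. is_path T p \<and> hd p \<in> S \<and> last p \<in> S \<longrightarrow> set p \<subseteq> S)"

lemma path_convexD: "path_convex T S \<Longrightarrow> is_path T p \<Longrightarrow> hd p \<in> S \<Longrightarrow> last p \<in> S \<Longrightarrow> set p \<subseteq> S"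
  by (auto simp: path_convex_def)

lemma path_convex_Int: "path_convex T A \<Longrightarrow> path_convex T B \<Longrightarrow> path_convex T (A \<inter> B)"
  by (auto simp: path_convex_def)

text \<open>A path from \<open>A\<close> to \<open>B\<close> splits at the node where a path from the common node \<open>c\<close> meets it. Its
  first half continues to \<open>c\<close> and so lies in \<open>A\<close>, its second half likewise in \<open>B\<close>.\<close>

lemma path_convex_Un:
  assumes con: "connected_graph T" and A: "path_convex T A" and B: "path_convex T B"
    and c: "c \<in> A" "c \<in> B"
  shows "path_convex T (A \<union> B)"
proof -
  have *: "set p \<subseteq> A \<union> B"
    if p: "is_path T p" and h: "hd p \<in> A" and l: "last p \<in> B" for p
  proof -
    have "c \<in> verts T" using A c by (auto simp: path_convex_def)
    then obtain p1 z p2 s where d: "p = p1 @ z # p2" "is_path T (p1 @ z # s)"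
      "is_path T (rev p2 @ z # s)" "last (z # s) = c"
      using path_meeting_node[OF con p] by blast
    have "set (p1 @ z # s) \<subseteq> A"
      by (rule path_convexD[OF A d(2)]) (use d h c in \<open>cases p1; auto\<close>)+
    moreover have "set (rev p2 @ z # s) \<subseteq> B"
      by (rule path_convexD[OF B d(3)])
        (use d l c in \<open>cases p2 rule: rev_cases; auto\<close>)+
    ultimately show ?thesis using d by auto
  qed
  have "set p \<subseteq> A \<union> B"
    if p: "is_path T p" and h: "hd p \<in> A \<union> B" and l: "last p \<in> A \<union> B" for p
  proof -
    have "p \<noteq> []" using p by (auto simp: is_path_def)
    then have "hd (rev p) = last p" "last (rev p) = hd p" by (simp_all add: hd_rev last_rev)
    then show ?thesis
      using *[OF p] *[OF is_path_rev[OF p]] path_convexD[OF A p] path_convexD[OF B p] h l by auto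
  qed
  then show ?thesis using A B by (auto simp: path_convex_def)
qed

text \<open>The median of three nodes lies on the three paths between them, and each of the sets contains
  one of these paths.\<close>

lemma path_convex_three:
  assumes con: "connected_graph T" and "path_convex T A" "path_convex T B" "path_convex T C"
    and "c \<in> A \<inter> B" "b \<in> A \<inter> C" "a \<in> B \<inter> C"
  shows "A \<inter> B \<inter> C \<noteq> {}"
proof -
  have v: "a \<in> verts T" "b \<in> verts T" "c \<in> verts T" using assms by (auto simp: path_convex_def)
  then obtain p where p: "is_path T p" "hd p = a" "last p = b"
    using con by (auto simp: connected_graph_def)
  obtain p1 z p2 s where d: "p = p1 @ z # p2" "is_path T (p1 @ z # s)"
    "is_path T (rev p2 @ z # s)" "last (z # s) = c"
    using path_meeting_node[OF con p(1) v(3)] by blast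
  have "set p \<subseteq> C" using path_convexD[OF assms(4) p(1)] p assms by auto
  moreover have "set (p1 @ z # s) \<subseteq> B"
    by (rule path_convexD[OF assms(3) d(2)]) (use d p assms in \<open>cases p1; auto\<close>)+
  moreover have "set (rev p2 @ z # s) \<subseteq> A"
    by (rule path_convexD[OF assms(2) d(3)])
      (use d p assms in \<open>cases p2 rule: rev_cases; auto\<close>)+
  ultimately show ?thesis using d by auto
qed

text \<open>The Helly property: intersecting all members with one of them keeps the family pairwise
  intersecting, by the case of three sets.\<close>

lemma path_convex_Helly:
  assumes con: "connected_graph T"
  shows "finite I \<Longrightarrow> I \<noteq> {} \<Longrightarrow> (\<And>i. i \<in> I \<Longrightarrow> path_convex T (S i)) \<Longrightarrow>
    (\<And>i j. i \<in> I \<Longrightarrow> j \<in> I \<Longrightarrow> S i \<inter> S j \<noteq> {}) \<Longrightarrow> (\<Inter>i\<in>I. S i) \<noteq> {}"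
proof (induction I arbitrary: S rule: finite_ne_induct)
  case (insert x F)
  have "(\<Inter>i\<in>F. S i \<inter> S x) \<noteq> {}"
  proof (rule insert.IH)
    fix i assume "i \<in> F"
    then show "path_convex T (S i \<inter> S x)" using insert.prems(1) by (auto intro: path_convex_Int)
  next
    fix i j assume ij: "i \<in> F" "j \<in> F"
    then obtain a b c where "a \<in> S j \<inter> S x" "b \<in> S i \<inter> S x" "c \<in> S i \<inter> S j"
      using insert.prems(2) by (metis ex_in_conv insertCI)
    then have "S i \<inter> S j \<inter> S x \<noteq> {}"
      using insert.prems(1) ij by (intro path_convex_three[OF con]) auto
    then show "S i \<inter> S x \<inter> (S j \<inter> S x) \<noteq> {}" by auto
  qed
  then show ?case using insert.hyps by auto
qed simp

text \<open>For a single vertex this is the defining condition of a tree-decomposition. Along a path in \<open>U\<close>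
  the node sets of consecutive vertices overlap, in a node whose part contains the edge, so that
  their union remains convex; and any two vertices of \<open>U\<close> are joined by such a path.\<close>

lemma tree_decomposition_nodes_convex:
  assumes td: "tree_decomposition G T V" and U: "U \<subseteq> verts G"
    and con: "connected_graph (induced_subgraph G U)"
  shows "path_convex T {t \<in> verts T. V t \<inter> U \<noteq> {}}"
proof -
  have cT: "connected_graph T" using td by (auto simp: tree_decomposition_def tree_def)
  let ?S = "\<lambda>A. {t \<in> verts T. V t \<inter> A \<noteq> {}}"
  have single: "path_convex T (?S {x})" for x
    unfolding path_convex_def
  proof (intro conjI allI impI subsetI)
    fix p t assume p: "is_path T p \<and> hd p \<in> ?S {x} \<and> last p \<in> ?S {x}" and t: "t \<in> set p"
    then have "V (hd p) \<inter> V (last p) \<subseteq> V t" using td by (auto simp: tree_decomposition_def)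
    then show "t \<in> ?S {x}" using p t by (auto simp: is_path_def)
  qed auto
  have path: "path_convex T (?S (set l))" if "l \<noteq> []" "path_edges l \<subseteq> edges G" for l
    using that
  proof (induction l rule: induct_list012)
    case (3 x y zs)
    then obtain t where "t \<in> verts T" "{x, y} \<subseteq> V t"
      using td by (fastforce simp: tree_decomposition_def)
    then have t: "t \<in> ?S {x}" "t \<in> ?S (set (y # zs))" by auto
    have "?S (set (x # y # zs)) = ?S {x} \<union> ?S (set (y # zs))" by auto
    moreover have "path_convex T (?S (set (y # zs)))" using 3 by auto
    ultimately show ?case using path_convex_Un[OF cT single _ t] by metis
  qed (use single in auto)
  show ?thesis
    unfolding path_convex_def
  proof (intro conjI allI impI)
    fix p assume p: "is_path T p \<and> hd p \<in> ?S U \<and> last p \<in> ?S U"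
    then obtain x y where xy: "x \<in> U" "x \<in> V (hd p)" "y \<in> U" "y \<in> V (last p)" by auto
    have "verts (induced_subgraph G U) = U" using U by (auto simp: induced_subgraph_def)
    then obtain l where l: "is_path (induced_subgraph G U) l" "hd l = x" "last l = y"
      using con xy unfolding connected_graph_def by metis
    then have l': "l \<noteq> []" "path_edges l \<subseteq> edges G" "set l \<subseteq> U"
      by (auto simp: is_path_def induced_subgraph_def)
    then have "x \<in> set l" "y \<in> set l" using l by auto
    then have "set p \<subseteq> ?S (set l)" using path_convexD[OF path[OF l'(1,2)]] p xy by blast
    then show "set p \<subseteq> ?S U" using l'(3) by auto
  qed auto
qed

text \<open>The easy direction of the duality between tree-width and brambles. By the Helly property it
  suffices that any two members of \<open>\<B>\<close> have a common node, and touching sets do: a part that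
  contains a common vertex or a connecting edge.\<close>

lemma bramble_cover:
  assumes td: "tree_decomposition G T V" and fin: "finite \<B>" "\<B> \<noteq> {}"
    and con: "\<And>U. U \<in> \<B> \<Longrightarrow> U \<subseteq> verts G \<and> connected_graph (induced_subgraph G U)"
    and touch: "\<And>U W. U \<in> \<B> \<Longrightarrow> W \<in> \<B> \<Longrightarrow>
      U \<inter> W \<noteq> {} \<or> (\<exists>x\<in>U. \<exists>y\<in>W. {x, y} \<in> edges G)"
  shows "\<exists>t\<in>verts T. \<forall>U\<in>\<B>. V t \<inter> U \<noteq> {}"
proof -
  have cT: "connected_graph T" using td by (auto simp: tree_decomposition_def tree_def)
  have cover: "verts G = (\<Union>t\<in>verts T. V t)" using td by (simp add: tree_decomposition_def)
  let ?S = "\<lambda>A. {t \<in> verts T. V t \<inter> A \<noteq> {}}"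
  have "(\<Inter>U\<in>\<B>. ?S U) \<noteq> {}"
  proof (rule path_convex_Helly[OF cT fin])
    fix U assume "U \<in> \<B>"
    then show "path_convex T (?S U)" using con tree_decomposition_nodes_convex[OF td] by blast
  next
    fix U W assume UW: "U \<in> \<B>" "W \<in> \<B>"
    obtain x y t where "x \<in> U" "y \<in> W" "t \<in> verts T" "{x, y} \<subseteq> V t"
    proof (cases "U \<inter> W = {}")
      case False
      then obtain x where "x \<in> U" "x \<in> W" by auto
      moreover from this obtain t where "t \<in> verts T" "x \<in> V t"
        using con[OF UW(1)] cover by blast
      ultimately show ?thesis using that by auto
    next
      case True
      then obtain x y where "x \<in> U" "y \<in> W" "{x, y} \<in> edges G" using touch[OF UW] by auto
      moreover from this obtain t where "t \<in> verts T" "{x, y} \<subseteq> V t"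
        using td by (auto simp: tree_decomposition_def)
      ultimately show ?thesis using that by auto
    qed
    then show "?S U \<inter> ?S W \<noteq> {}" by auto
  qed
  then show ?thesis using fin by auto
qed


section \<open>Building tree-decompositions by adding leaf bags\<close>

lemma cycle_edges_nth:
  assumes "c \<noteq> []"
  shows "cycle_edges c = (\<lambda>i. {c ! i, c ! (Suc i mod length c)}) ` {..<length c}"
proof -
  obtain l where l: "length c = Suc l" using assms by (cases c) auto
  have "path_edges c = (\<lambda>i. {c ! i, c ! Suc i}) ` {..<l}"
    using l by (auto simp: path_edges_def)
  also have "\<dots> = (\<lambda>i. {c ! i, c ! (Suc i mod length c)}) ` {..<l}"
    using l by (intro image_cong) auto
  finally show ?thesis
    using assms l by (simp add: cycle_edges_def lessThan_Suc last_conv_nth hd_conv_nth)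
qed

lemma cycle_vertex_edges:
  assumes c: "distinct c" "length c \<ge> 3" and x: "x \<in> set c"
  obtains y z where "y \<in> set c" "z \<in> set c" "y \<noteq> z" "x \<noteq> y" "x \<noteq> z"
    "{e \<in> cycle_edges c. x \<in> e} = {{x, y}, {x, z}}"
proof -
  let ?L = "length c"
  obtain j where j: "j < ?L" "x = c ! j" using x by (auto simp: in_set_conv_nth)
  define a where "a = Suc j mod ?L"
  define b where "b = (if j = 0 then ?L - 1 else j - 1)"
  have aj: "a = (if Suc j = ?L then 0 else Suc j)" using j by (auto simp: a_def)
  have lt: "a < ?L" "b < ?L" "a \<noteq> b" "a \<noteq> j" "b \<noteq> j" and bj: "Suc b mod ?L = j"
    using j c unfolding aj b_def by auto
  have uniq: "i = b" if "i < ?L" "Suc i mod ?L = j" for i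
    using that j c by (cases "Suc i = ?L") (auto simp: b_def)
  have inj: "c ! i = c ! i' \<longleftrightarrow> i = i'" if "i < ?L" "i' < ?L" for i i'
    using that c by (simp add: nth_eq_iff_index_eq)
  have "{e \<in> cycle_edges c. x \<in> e} = {{c ! j, c ! a}, {c ! j, c ! b}}"
  proof (intro set_eqI iffI)
    fix e assume "e \<in> {e \<in> cycle_edges c. x \<in> e}"
    then obtain i where i: "i < ?L" "e = {c ! i, c ! (Suc i mod ?L)}" "x \<in> e"
      using cycle_edges_nth[of c] x by force
    have "Suc i mod ?L < ?L" using c by (intro mod_less_divisor) auto
    then have "j = i \<or> j = Suc i mod ?L" using i j inj by auto
    then show "e \<in> {{c ! j, c ! a}, {c ! j, c ! b}}"
      using i uniq[of i] by (auto simp: a_def insert_commute)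
  next
    fix e assume "e \<in> {{c ! j, c ! a}, {c ! j, c ! b}}"
    moreover have "{c ! j, c ! a} \<in> cycle_edges c"
    proof -
      have "c \<noteq> []" using c by auto
      then show ?thesis unfolding cycle_edges_nth[OF \<open>c \<noteq> []\<close>] using j(1) a_def by blast
    qed
    moreover have "{c ! b, c ! j} \<in> cycle_edges c"
    proof -
      have "c \<noteq> []" using c by auto
      then show ?thesis unfolding cycle_edges_nth[OF \<open>c \<noteq> []\<close>] using lt(2) bj by force
    qed
    ultimately show "e \<in> {e \<in> cycle_edges c. x \<in> e}" using j by (auto simp: insert_commute)
  qed
  then show ?thesis using that[of "c ! a" "c ! b"] j lt inj by auto
qed

lemma cycle_edges_subset_set: "c \<noteq> [] \<Longrightarrow> e \<in> cycle_edges c \<Longrightarrow> e \<subseteq> set c"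
  using path_edges_subset_set by (fastforce simp: cycle_edges_def)

locale new_leaf =
  fixes T :: "'t sgraph" and s t :: 't
  assumes T: "tree T" and t: "t \<in> verts T" and s: "s \<notin> verts T"
begin

definition T' :: "'t sgraph" where
  "T' = \<lparr> verts = insert s (verts T), edges = insert {s, t} (edges T) \<rparr>"

lemma verts_T' [simp]: "verts T' = insert s (verts T)"
  and edges_T' [simp]: "edges T' = insert {s, t} (edges T)"
  by (auto simp: T'_def)

lemma edge_T: "e \<in> edges T \<Longrightarrow> e \<subseteq> verts T"
  using T by (fastforce simp: tree_def simple_graph_def)

lemma edge_s: "{s, x} \<in> edges T' \<Longrightarrow> x = t"
  using edge_T s by (auto simp: doubleton_eq_iff)

lemma path_without_s:
  assumes "is_path T' p" "s \<notin> set p" shows "is_path T p"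
proof -
  have "{s, t} \<notin> path_edges p" using assms(2) path_edges_subset_set by fastforce
  then show ?thesis using assms by (auto simp: is_path_def)
qed

text \<open>The new node has a single neighbour, so it cannot be an inner node of a path.\<close>

lemma s_end_of_path:
  assumes p: "is_path T' p" and sp: "s \<in> set p"
  shows "p = [s] \<or> (\<exists>p'. p = s # p' \<and> is_path T p' \<and> hd p' = t) \<or>
    (\<exists>p'. p = p' @ [s] \<and> is_path T p' \<and> last p' = t)"
proof -
  obtain xs ys where d: "p = xs @ s # ys" using sp by (metis split_list)
  have dist: "distinct p" using p by (simp add: is_path_def)
  have hy: "hd ys = t" if "ys \<noteq> []"
  proof -
    have "{s, hd ys} \<in> path_edges p"
      using that d by (cases ys; cases "xs = []") (auto simp: path_edges_append)
    then show ?thesis using p edge_s by (auto simp: is_path_def)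
  qed
  have lx: "last xs = t" if "xs \<noteq> []"
  proof -
    have "{s, last xs} \<in> path_edges p"
      using that d by (auto simp: path_edges_append insert_commute)
    then show ?thesis using p edge_s by (auto simp: is_path_def)
  qed
  have "xs = [] \<or> ys = []"
  proof (rule ccontr)
    assume "\<not> ?thesis"
    then have "t \<in> set xs" "t \<in> set ys" using hy lx by (metis last_in_set, metis hd_in_set)
    then show False using dist d by auto
  qed
  then consider "xs = []" "ys = []" | "xs = []" "ys \<noteq> []" | "xs \<noteq> []" "ys = []" by auto
  then show ?thesis
  proof cases
    case 2
    then have "is_path T' ys" using p d is_path_suffix[of T' "[s]" ys] by auto
    then show ?thesis using 2 d dist hy path_without_s[of ys] by auto
  next
    case 3
    then have "is_path T' xs" using p d is_path_prefix[of T' xs "[s]"] by auto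
    then show ?thesis using 3 d dist lx path_without_s[of xs] by auto
  qed (use d in auto)
qed

lemma path_T': "is_path T p \<Longrightarrow> is_path T' p"
  by (auto simp: is_path_def)

lemma tree_T': "tree T'"
  unfolding tree_def
proof (intro conjI)
  show "simple_graph T'"
    unfolding simple_graph_def
  proof (intro conjI ballI)
    show "finite (verts T')" using T by (auto simp: tree_def simple_graph_def)
    fix e assume "e \<in> edges T'"
    then consider "e = {s, t}" | "e \<in> edges T" by auto
    then show "\<exists>u\<in>verts T'. \<exists>v\<in>verts T'. u \<noteq> v \<and> e = {u, v}"
    proof cases
      case 1
      moreover have "s \<noteq> t" using s t by auto
      ultimately show ?thesis using t by auto
    next
      case 2
      then obtain u v where "u \<in> verts T" "v \<in> verts T" "u \<noteq> v" "e = {u, v}"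
        using T unfolding tree_def simple_graph_def by blast
      then show ?thesis unfolding verts_T' by blast
    qed
  qed
next
  have conT: "\<exists>p. is_path T' p \<and> hd p = u \<and> last p = v"
    if "u \<in> verts T" "v \<in> verts T" for u v
    using T that path_T' unfolding tree_def connected_graph_def by blast
  have from_s: "\<exists>p. is_path T' p \<and> hd p = s \<and> last p = v" if v: "v \<in> verts T" for v
  proof -
    obtain p where p: "is_path T p" "hd p = t" "last p = v"
      using T t v unfolding tree_def connected_graph_def by blast
    then have "is_path T' ([] @ s # p)"
      using s by (cases p) (auto simp: is_path_def)
    then show ?thesis using p by (intro exI[of _ "s # p"]) (auto simp: is_path_def)
  qed
  have to_s: "\<exists>p. is_path T' p \<and> hd p = v \<and> last p = s" if v: "v \<in> verts T" for v
  proof -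
    obtain p where p: "is_path T' p" "hd p = s" "last p = v" using from_s[OF v] by blast
    then have "p \<noteq> []" by (auto simp: is_path_def)
    then show ?thesis using p is_path_rev[OF p(1)]
      by (intro exI[of _ "rev p"]) (auto simp: hd_rev last_rev)
  qed
  have "is_path T' [s]" by (auto simp: is_path_def)
  then have "\<exists>p. is_path T' p \<and> hd p = s \<and> last p = s" by (intro exI[of _ "[s]"]) auto
  then show "connected_graph T'"
    unfolding connected_graph_def using conT from_s to_s by auto
next
  show "\<nexists>c. is_cycle T' c"
  proof
    assume "\<exists>c. is_cycle T' c"
    then obtain c where c: "is_cycle T' c" ..
    then have cc: "distinct c" "length c \<ge> 3" "c \<noteq> []" by (auto simp: is_cycle_def)
    show False
    proof (cases "s \<in> set c")
      case True
      obtain y z where yz: "y \<noteq> z" "{e \<in> cycle_edges c. s \<in> e} = {{s, y}, {s, z}}"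
        by (rule cycle_vertex_edges[OF cc(1,2) True])
      then have "{s, y} \<in> edges T'" "{s, z} \<in> edges T'" using c by (auto simp: is_cycle_def)
      then show False using edge_s yz(1) by metis
    next
      case False
      then have "{s, t} \<notin> cycle_edges c" using cycle_edges_subset_set[OF cc(3)] by blast
      then have "is_cycle T c" using c False by (auto simp: is_cycle_def)
      then show False using T by (auto simp: tree_def)
    qed
  qed
qed

end

text \<open>The sets \<open>\<V>\<close> of parts of tree-decompositions, without the graph and without the tree. A tree
  arises by adding leaves one by one, and the condition on a new part \<open>A\<close> is that it meets the
  union of the old parts only within the part \<open>C\<close> that it is attached to. Any graph whose edges are
  each contained in a part may be put back in afterwards.\<close>

inductive bag_tree :: "'a set set \<Rightarrow> bool" where
  single: "bag_tree {C}"
| leaf: "bag_tree \<V> \<Longrightarrow> C \<in> \<V> \<Longrightarrow> A \<inter> \<Union>\<V> \<subseteq> C \<Longrightarrow> bag_tree (insert A \<V>)"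

lemma bag_tree_realize:
  assumes "bag_tree \<V>"
  shows "\<exists>(T :: nat sgraph) V. tree T \<and> V ` verts T = \<V> \<and>
    (\<forall>p. is_path T p \<longrightarrow> (\<forall>t\<in>set p. V (hd p) \<inter> V (last p) \<subseteq> V t))"
  using assms
proof induction
  case (single C)
  let ?T = "\<lparr> verts = {0::nat}, edges = {} \<rparr>"
  have path: "is_path ?T [0]" by (auto simp: is_path_def)
  have "\<not> is_cycle ?T c" for c
    by (auto simp: is_cycle_def cycle_edges_def)
  moreover have "connected_graph ?T"
    using path by (auto simp: connected_graph_def intro!: exI[of _ "[0]"])
  ultimately have "tree ?T"
    by (auto simp: tree_def simple_graph_def)
  then show ?case by (intro exI[of _ ?T] exI[of _ "\<lambda>_. C"]) auto
next
  case (leaf \<V> C A)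
  from leaf.IH obtain T :: "nat sgraph" and V where tr: "tree T" "V ` verts T = \<V>"
    and conv: "\<And>p t. is_path T p \<Longrightarrow> t \<in> set p \<Longrightarrow> V (hd p) \<inter> V (last p) \<subseteq> V t"
    by blast
  obtain t where tC: "t \<in> verts T" "V t = C" using tr leaf.hyps by auto
  obtain s where s: "s \<notin> verts T"
    using tr ex_new_if_finite[of "verts T"] by (auto simp: tree_def simple_graph_def)
  interpret new_leaf T s t by unfold_locales (use tr tC s in auto)
  let ?V = "V(s := A)"
  have V_T: "?V x = V x" if "x \<in> verts T" for x using that s by auto
  have in_T: "x \<in> verts T" if "is_path T p" "x \<in> set p" for x p
    using that by (auto simp: is_path_def)
  have leaf_path: "A \<inter> V (last p) \<subseteq> V x" if p: "is_path T p" "hd p = t" "x \<in> set p" for p x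
  proof -
    have "last p \<in> verts T" using p in_T last_in_set by (metis is_path_def)
    then have "A \<inter> V (last p) \<subseteq> A \<inter> \<Union>\<V>" using tr(2) by blast
    then have "A \<inter> V (last p) \<subseteq> C" using leaf.hyps by blast
    then have "A \<inter> V (last p) \<subseteq> V (hd p)" using p(2) tC(2) by simp
    then show ?thesis using conv[OF p(1,3)] by blast
  qed
  have "?V (hd p) \<inter> ?V (last p) \<subseteq> ?V x" if p: "is_path T' p" and x: "x \<in> set p" for p x
  proof (cases "s \<in> set p")
    case False
    then show ?thesis
      using conv[OF path_without_s[OF p False] x] p x by (auto simp: is_path_def)
  next
    case True
    from s_end_of_path[OF p True] show ?thesis
    proof (elim disjE exE conjE)
      assume "p = [s]" then show ?thesis using x by auto
    next
      fix p' assume p': "p = s # p'" "is_path T p'" "hd p' = t"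
      then have "p' \<noteq> []" "last p' \<noteq> s" using in_T s last_in_set by (auto simp: is_path_def)
      then show ?thesis using leaf_path[OF p'(2,3)] x p' s in_T by fastforce
    next
      fix p' assume p': "p = p' @ [s]" "is_path T p'" "last p' = t"
      then have ne: "p' \<noteq> []" "hd p' \<noteq> s" using in_T s hd_in_set by (auto simp: is_path_def)
      have "is_path T (rev p')" "hd (rev p') = t" "last (rev p') = hd p'"
        using p' ne by (auto simp: is_path_rev hd_rev last_rev)
      then show ?thesis using leaf_path[of "rev p'"] x p' s in_T ne by fastforce
    qed
  qed
  moreover have "?V ` verts T' = insert A \<V>" using tr s by auto
  ultimately show ?case using tree_T' by blast
qed

lemma tree_decomposition_of_bag_tree:
  assumes "bag_tree \<V>" "verts G = \<Union>\<V>" "\<And>e. e \<in> edges G \<Longrightarrow> \<exists>A\<in>\<V>. e \<subseteq> A"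
  obtains T :: "nat sgraph" and V where "tree_decomposition G T V" "V ` verts T = \<V>"
proof -
  obtain T :: "nat sgraph" and V where T: "tree T" "V ` verts T = \<V>"
    and conv: "\<And>p t. is_path T p \<Longrightarrow> t \<in> set p \<Longrightarrow> V (hd p) \<inter> V (last p) \<subseteq> V t"
    using bag_tree_realize[OF assms(1)] by blast
  have "tree_decomposition G T V"
    unfolding tree_decomposition_def using T conv assms(2,3) by blast
  then show ?thesis using that T by blast
qed

lemma bag_tree_star:
  assumes "finite \<F>" "\<And>A A'. A \<in> \<F> \<Longrightarrow> A' \<in> \<F> \<Longrightarrow> A \<noteq> A' \<Longrightarrow> A \<inter> A' \<subseteq> C"
  shows "bag_tree (insert C \<F>)"
  using assms
proof (induction rule: finite_induct)
  case empty
  show ?case by (rule bag_tree.single)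
next
  case (insert A \<F>)
  have "A \<inter> A' \<subseteq> C" if "A' \<in> \<F>" for A' using insert.prems[of A A'] insert.hyps that by auto
  then have "A \<inter> \<Union>(insert C \<F>) \<subseteq> C" by blast
  moreover have "bag_tree (insert C \<F>)" by (rule insert.IH) (use insert.prems in blast)
  ultimately have "bag_tree (insert A (insert C \<F>))"
    using bag_tree.leaf[OF _ insertI1] by blast
  then show ?case by (simp add: insert_commute)
qed

lemma width_le_iff:
  assumes "tree_decomposition G T V"
  shows "width T V \<le> w \<longleftrightarrow> (\<forall>A\<in>V ` verts T. card A - 1 \<le> w)"
proof -
  have "finite (verts T)" "verts T \<noteq> {}"
    using assms by (auto simp: tree_decomposition_def tree_def simple_graph_def connected_graph_def)
  then show ?thesis by (simp add: width_def)
qed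


section \<open>Subdivided complete graphs\<close>

text \<open>Here \<open>B\<close> is the set of branch vertices, \<open>m\<close> is the length of a subdivided edge and \<open>q u v i\<close> is
  the vertex at distance \<open>i\<close> from \<open>u\<close> on the subdivided edge between \<open>u\<close> and \<open>v\<close>. Parametrizing every
  subdivided edge from both of its ends keeps all arguments symmetric in \<open>u\<close> and \<open>v\<close>; the price is
  that an inner vertex has exactly two such descriptions, which is the content of the assumption
  on inner vertices.\<close>

locale subdivided_clique =
  fixes G :: "'a sgraph" and B :: "'a set" and m :: nat and q :: "'a \<Rightarrow> 'a \<Rightarrow> nat \<Rightarrow> 'a"
  assumes finite_B: "finite B" and card_B: "3 \<le> card B" and m_pos: "0 < m"
    and q_0: "\<lbrakk>u \<in> B; v \<in> B; u \<noteq> v\<rbrakk> \<Longrightarrow> q u v 0 = u"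
    and q_rev: "\<lbrakk>u \<in> B; v \<in> B; u \<noteq> v; i \<le> m\<rbrakk> \<Longrightarrow> q v u i = q u v (m - i)"
    and q_inner: "\<lbrakk>u \<in> B; v \<in> B; u \<noteq> v; x \<in> B; y \<in> B; x \<noteq> y; 0 < i; i < m; j \<le> m;
        q u v i = q x y j\<rbrakk> \<Longrightarrow> (x = u \<and> y = v \<and> j = i) \<or> (x = v \<and> y = u \<and> j = m - i)"
    and verts_G: "verts G = {q u v i |u v i. u \<in> B \<and> v \<in> B \<and> u \<noteq> v \<and> i \<le> m}"
    and edges_G: "edges G = {{q u v i, q u v (Suc i)} |u v i. u \<in> B \<and> v \<in> B \<and> u \<noteq> v \<and> i < m}"
begin

lemma q_m: "\<lbrakk>u \<in> B; v \<in> B; u \<noteq> v\<rbrakk> \<Longrightarrow> q u v m = v"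
  using q_rev[of u v 0] q_0[of v u] by simp

lemma ex_other: "\<exists>w\<in>B. w \<noteq> u \<and> w \<noteq> v"
proof (rule ccontr)
  assume "\<not> ?thesis"
  then have "B \<subseteq> {u, v}" by auto
  then have "card B \<le> card {u, v}" by (intro card_mono) auto
  also have "\<dots> \<le> 2" by (simp add: card_insert_if)
  finally show False using card_B by simp
qed

lemma inner_notin_B: "\<lbrakk>u \<in> B; v \<in> B; u \<noteq> v; 0 < i; i < m\<rbrakk> \<Longrightarrow> q u v i \<notin> B"
proof
  assume a: "u \<in> B" "v \<in> B" "u \<noteq> v" "0 < i" "i < m" "q u v i \<in> B"
  obtain w where "w \<in> B" "w \<noteq> q u v i" using ex_other by metis
  then show False using q_inner[of u v "q u v i" w i 0] q_0[of "q u v i" w] a by auto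
qed

lemma q_inj: "\<lbrakk>u \<in> B; v \<in> B; u \<noteq> v; i \<le> m; j \<le> m; q u v i = q u v j\<rbrakk> \<Longrightarrow> i = j"
proof -
  assume a: "u \<in> B" "v \<in> B" "u \<noteq> v" "i \<le> m" "j \<le> m" and eq: "q u v i = q u v j"
  consider "0 < i" "i < m" | "0 < j" "j < m" | "i \<in> {0, m}" "j \<in> {0, m}" using a by fastforce
  then show ?thesis
  proof cases
    case 1 then show ?thesis using q_inner[of u v u v i j] a eq by auto
  next
    case 2 then show ?thesis using q_inner[of u v u v j i] a eq by auto
  next
    case 3 then show ?thesis using a eq q_0[of u v] q_m[of u v] by auto
  qed
qed

lemma q_in_B_iff:
  assumes "u \<in> B" "v \<in> B" "u \<noteq> v" "i \<le> m"
  shows "q u v i \<in> B \<longleftrightarrow> i = 0 \<or> i = m"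
  using assms inner_notin_B[of u v i] q_0[of u v] q_m[of u v] by (cases "i = 0"; cases "i = m") auto

lemma B_subset_verts: "B \<subseteq> verts G"
proof
  fix u assume "u \<in> B"
  moreover obtain w where "w \<in> B" "w \<noteq> u" using ex_other by blast
  ultimately show "u \<in> verts G" using q_0[of u w] unfolding verts_G by force
qed

lemma finite_verts: "finite (verts G)"
proof -
  have "verts G \<subseteq> (\<lambda>(u, v, i). q u v i) ` (B \<times> B \<times> {..m})" unfolding verts_G by force
  then show ?thesis using finite_B by (meson finite_SigmaI finite_atMost finite_imageI finite_subset)
qed

definition edge :: "'a \<Rightarrow> 'a \<Rightarrow> nat \<Rightarrow> 'a set" where
  "edge u v i = {q u v i, q u v (Suc i)}"

lemma edges_G': "edges G = {edge u v i |u v i. u \<in> B \<and> v \<in> B \<and> u \<noteq> v \<and> i < m}"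
  unfolding edges_G edge_def ..

lemma edge_in: "\<lbrakk>u \<in> B; v \<in> B; u \<noteq> v; i < m\<rbrakk> \<Longrightarrow> edge u v i \<in> edges G"
  unfolding edges_G' by blast

lemma finite_edges: "finite (edges G)"
proof -
  have "edges G \<subseteq> (\<lambda>(u, v, i). edge u v i) ` (B \<times> B \<times> {..m})" unfolding edges_G' by force
  then show ?thesis using finite_B by (meson finite_SigmaI finite_atMost finite_imageI finite_subset)
qed

lemma edge_rev: "\<lbrakk>u \<in> B; v \<in> B; u \<noteq> v; i < m\<rbrakk> \<Longrightarrow> edge v u i = edge u v (m - Suc i)"
  using q_rev[of u v i] q_rev[of u v "Suc i"] by (auto simp: edge_def Suc_diff_Suc insert_commute)

lemma edge_eqD:
  assumes "u \<in> B" "v \<in> B" "u \<noteq> v" "x \<in> B" "y \<in> B" "x \<noteq> y" "i < m" "j < m"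
    and eq: "edge u v i = edge x y j"
  shows "(x = u \<and> y = v \<and> j = i) \<or> (x = v \<and> y = u \<and> j = m - Suc i)"
proof -
  have same: "k = i" if "k < m" "edge u v i = edge u v k" for k
  proof -
    have "q u v i \<in> {q u v k, q u v (Suc k)}" "q u v (Suc i) \<in> {q u v k, q u v (Suc k)}"
      using that by (auto simp: edge_def)
    then have "i \<in> {k, Suc k}" "Suc i \<in> {k, Suc k}"
      using q_inj[of u v i k] q_inj[of u v i "Suc k"] q_inj[of u v "Suc i" k]
        q_inj[of u v "Suc i" "Suc k"] that assms by auto
    then show ?thesis by auto
  qed
  have "(x = u \<and> y = v) \<or> (x = v \<and> y = u)"
  proof (cases "m = 1")
    case True
    then have "{u, v} = {x, y}"
      using eq assms q_0[of u v] q_0[of x y] q_m[of u v] q_m[of x y] by (simp add: edge_def)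
    then show ?thesis by (auto simp: doubleton_eq_iff)
  next
    case False
    then obtain l where l: "l = i \<or> l = Suc i" "0 < l" "l < m"
      using assms by (cases "i = 0") auto
    then have "q u v l \<in> {q x y j, q x y (Suc j)}" using eq by (auto simp: edge_def)
    then obtain j' where "q u v l = q x y j'" "j' \<le> m" using assms by auto
    then show ?thesis using q_inner[of u v x y l j'] assms l by auto
  qed
  then show ?thesis
  proof
    assume xy: "x = u \<and> y = v"
    then have "edge u v i = edge u v j" using eq by simp
    then show ?thesis using same[OF assms(8)] xy by simp
  next
    assume xy: "x = v \<and> y = u"
    then have "edge u v i = edge u v (m - Suc j)" using eq edge_rev[OF assms(1-3,8)] by simp
    then have "m - Suc j = i" using same[of "m - Suc j"] m_pos by simp
    then show ?thesis using xy assms(8) by auto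
  qed
qed


section \<open>The cycle space\<close>

text \<open>The cycle space enters through this condition: the edge sets in which every vertex has even
  degree. Cycles have it, it is preserved by addition, and by \<open>even_deg_in_span\<close> below it
  characterizes the span of the triangles.\<close>

definition even_deg :: "('a set \<Rightarrow> bit) \<Rightarrow> bool" where
  "even_deg f \<longleftrightarrow> (\<forall>e. e \<notin> edges G \<longrightarrow> f e = 0) \<and> (\<forall>x. (\<Sum>e\<in>{e \<in> edges G. x \<in> e}. f e) = 0)"

lemma even_deg_add: "even_deg f \<Longrightarrow> even_deg g \<Longrightarrow> even_deg (f + g)"
proof -
  assume f: "even_deg f" and g: "even_deg g"
  have "(\<Sum>e\<in>S. (f + g) e) = (\<Sum>e\<in>S. f e) + (\<Sum>e\<in>S. g e)" for S
    unfolding plus_fun_def by (rule sum.distrib)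
  then show "even_deg (f + g)" using f g unfolding even_deg_def by simp
qed

lemma even_deg_cycle:
  assumes c: "is_cycle G c"
  shows "even_deg (indicator (cycle_edges c))"
  unfolding even_deg_def
proof (intro conjI allI impI)
  fix e assume "e \<notin> edges G"
  then have "e \<notin> cycle_edges c" using c by (auto simp: is_cycle_def)
  then show "indicator (cycle_edges c) e = (0 :: bit)" by simp
next
  fix x
  have cc: "distinct c" "length c \<ge> 3" "c \<noteq> []" using c by (auto simp: is_cycle_def)
  have "(\<Sum>e\<in>{e \<in> edges G. x \<in> e}. indicator (cycle_edges c) e :: bit)
      = (\<Sum>e\<in>{e \<in> cycle_edges c. x \<in> e}. 1)"
    using c finite_edges
    by (intro sum.mono_neutral_cong_right) (auto simp: is_cycle_def indicator_def)
  also have "\<dots> = 0"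
  proof (cases "x \<in> set c")
    case True
    obtain y z where "y \<noteq> z" "x \<noteq> y" "x \<noteq> z"
      "{e \<in> cycle_edges c. x \<in> e} = {{x, y}, {x, z}}"
      by (rule cycle_vertex_edges[OF cc(1,2) True])
    then show ?thesis by (simp add: doubleton_eq_iff)
  next
    case False
    then have "{e \<in> cycle_edges c. x \<in> e} = {}" using cycle_edges_subset_set[OF cc(3)] by blast
    then show ?thesis by (simp only: sum.empty)
  qed
  finally show "(\<Sum>e\<in>{e \<in> edges G. x \<in> e}. indicator (cycle_edges c) e :: bit) = 0" .
qed

lemma inner_incident:
  assumes "u \<in> B" "v \<in> B" "u \<noteq> v" "Suc i < m"
  shows "{e \<in> edges G. q u v (Suc i) \<in> e} = {edge u v i, edge u v (Suc i)}"
proof (intro set_eqI iffI)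
  fix e assume "e \<in> {e \<in> edges G. q u v (Suc i) \<in> e}"
  then obtain x y j where e: "e = edge x y j" "x \<in> B" "y \<in> B" "x \<noteq> y" "j < m"
    "q u v (Suc i) \<in> edge x y j" unfolding edges_G' by blast
  then obtain l where l: "l = j \<or> l = Suc j" "q u v (Suc i) = q x y l" by (auto simp: edge_def)
  then have "(x = u \<and> y = v \<and> l = Suc i) \<or> (x = v \<and> y = u \<and> l = m - Suc i)"
    using q_inner[OF assms(1-3) e(2-4) _ assms(4) _ l(2)] l(1) e(5) by auto
  then show "e \<in> {edge u v i, edge u v (Suc i)}"
  proof
    assume "x = u \<and> y = v \<and> l = Suc i"
    then show ?thesis using l(1) e(1) by auto
  next
    assume a: "x = v \<and> y = u \<and> l = m - Suc i"
    then have "m - Suc j = i \<or> m - Suc j = Suc i" using l(1) e(5) assms(4) by auto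
    moreover have "e = edge u v (m - Suc j)" using edge_rev[OF assms(1-3) e(5)] a e(1) by simp
    ultimately show ?thesis by auto
  qed
next
  fix e assume "e \<in> {edge u v i, edge u v (Suc i)}"
  moreover have "edge u v i \<in> edges G" "edge u v (Suc i) \<in> edges G"
    using assms by (simp_all add: edge_in)
  moreover have "q u v (Suc i) \<in> edge u v i" "q u v (Suc i) \<in> edge u v (Suc i)"
    by (simp_all add: edge_def)
  ultimately show "e \<in> {e \<in> edges G. q u v (Suc i) \<in> e}" by blast
qed

lemma branch_incident:
  assumes "u \<in> B"
  shows "{e \<in> edges G. u \<in> e} = (\<lambda>v. edge u v 0) ` (B - {u})"
proof (intro set_eqI iffI)
  fix e assume "e \<in> {e \<in> edges G. u \<in> e}"
  then obtain x y j where e: "e = edge x y j" "x \<in> B" "y \<in> B" "x \<noteq> y" "j < m"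
    "u \<in> edge x y j" unfolding edges_G' by blast
  then obtain l where l: "l = j \<or> l = Suc j" "u = q x y l" by (auto simp: edge_def)
  then have "l = 0 \<or> l = m" using q_in_B_iff[of x y l] e assms by auto
  then show "e \<in> (\<lambda>v. edge u v 0) ` (B - {u})"
  proof
    assume "l = 0"
    then show ?thesis using l e q_0[of x y] by auto
  next
    assume "l = m"
    then have "u = y" "j = m - Suc 0" using l e q_m[of x y] by auto
    then have "e = edge u x 0" using e edge_rev[of x y 0] m_pos by auto
    then show ?thesis using e \<open>u = y\<close> by auto
  qed
next
  fix e assume "e \<in> (\<lambda>v. edge u v 0) ` (B - {u})"
  then show "e \<in> {e \<in> edges G. u \<in> e}"
    using edge_in[of u _ 0] m_pos assms q_0[of u] by (auto simp: edge_def[of u])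
qed

text \<open>Inner vertices have degree two, so an even edge set contains a subdivided edge entirely or not
  at all. It is thus determined by its values on the first edges \<open>edge u v 0\<close>, which form an even
  edge set of the complete graph.\<close>

lemma even_deg_const:
  assumes f: "even_deg f" and uv: "u \<in> B" "v \<in> B" "u \<noteq> v"
  shows "i < m \<Longrightarrow> f (edge u v i) = f (edge u v 0)"
proof (induction i)
  case (Suc i)
  have "edge u v i \<noteq> edge u v (Suc i)"
    using edge_eqD[of u v u v i "Suc i"] uv Suc.prems by auto
  moreover have "(\<Sum>e\<in>{edge u v i, edge u v (Suc i)}. f e) = 0"
    using f unfolding even_deg_def inner_incident[OF uv Suc.prems, symmetric] by blast
  ultimately have "f (edge u v i) + f (edge u v (Suc i)) = 0" by simp
  moreover have "a + b = 0 \<Longrightarrow> a = b" for a b :: bit by (cases a; cases b) simp_all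
  ultimately have "f (edge u v i) = f (edge u v (Suc i))" by blast
  then show ?case using Suc by simp
qed simp

lemma even_deg_sym:
  assumes "even_deg f" and uv: "u \<in> B" "v \<in> B" "u \<noteq> v"
  shows "f (edge v u 0) = f (edge u v 0)"
  using even_deg_const[OF assms, of "m - Suc 0"] edge_rev[OF uv, of 0] m_pos by simp

lemma even_deg_branch:
  assumes f: "even_deg f" and u: "u \<in> B"
  shows "(\<Sum>v\<in>B - {u}. f (edge u v 0)) = 0"
proof -
  have "inj_on (\<lambda>v. edge u v 0) (B - {u})"
    using edge_eqD[of u _ u _ 0 0] m_pos u by (intro inj_onI) blast
  then have "(\<Sum>v\<in>B - {u}. f (edge u v 0)) = (\<Sum>e\<in>{e \<in> edges G. u \<in> e}. f e)"
    by (simp add: branch_incident[OF u] sum.reindex)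
  then show ?thesis using f by (simp add: even_deg_def)
qed

lemma even_deg_second:
  assumes f: "even_deg f" and uv: "u \<in> B" "v \<in> B" "u \<noteq> v" and nz: "f (edge u v 0) \<noteq> 0"
  shows "\<exists>w\<in>B. w \<noteq> u \<and> w \<noteq> v \<and> f (edge u w 0) \<noteq> 0"
proof (rule ccontr)
  assume "\<not> ?thesis"
  then have "(\<Sum>w\<in>B - {u}. f (edge u w 0)) = (\<Sum>w\<in>{v}. f (edge u w 0))"
    using uv finite_B by (intro sum.mono_neutral_right) auto
  then show False using even_deg_branch[OF f uv(1)] nz by simp
qed

text \<open>If the subdivided edge between \<open>u\<close> and \<open>v\<close> is used, then parity at \<open>u\<close> and at \<open>v\<close> forces one
  further subdivided edge at each of them, and these three are distinct.\<close>

lemma even_deg_support_card: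
  assumes f: "even_deg f" and nz: "f \<noteq> 0"
  shows "3 * m \<le> card {e \<in> edges G. f e \<noteq> 0}"
proof -
  obtain e where "f e \<noteq> 0" using nz by (auto simp: fun_eq_iff)
  then have "e \<in> edges G" using f by (auto simp: even_deg_def)
  then obtain u v i where uv: "u \<in> B" "v \<in> B" "u \<noteq> v" "i < m" "e = edge u v i"
    unfolding edges_G' by blast
  have "f (edge u v 0) \<noteq> 0" using \<open>f e \<noteq> 0\<close> even_deg_const[OF f uv(1-4)] uv(5) by simp
  then have nz': "f (edge u v 0) \<noteq> 0" "f (edge v u 0) \<noteq> 0"
    using even_deg_sym[OF f uv(1-3)] by simp_all
  obtain w where w: "w \<in> B" "w \<noteq> u" "w \<noteq> v" "f (edge u w 0) \<noteq> 0"
    using even_deg_second[OF f uv(1-3) nz'(1)] by blast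
  obtain w' where w': "w' \<in> B" "w' \<noteq> v" "w' \<noteq> u" "f (edge v w' 0) \<noteq> 0"
    using even_deg_second[OF f uv(2,1) _ nz'(2)] uv by blast
  let ?S = "\<lambda>x y. edge x y ` {..<m}"
  have inj: "inj_on (edge x y) {..<m}" if "x \<in> B" "y \<in> B" "x \<noteq> y" for x y
    using edge_eqD[of x y x y] that by (intro inj_onI) auto
  have disj: "?S x y \<inter> ?S x' y' = {}"
    if "x \<in> B" "y \<in> B" "x \<noteq> y" "x' \<in> B" "y' \<in> B" "x' \<noteq> y'"
      "\<not> (x' = x \<and> y' = y)" "\<not> (x' = y \<and> y' = x)" for x y x' y'
    using edge_eqD[of x y x' y'] that by fastforce
  have sub: "?S x y \<subseteq> {e \<in> edges G. f e \<noteq> 0}"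
    if "x \<in> B" "y \<in> B" "x \<noteq> y" "f (edge x y 0) \<noteq> 0" for x y
  proof
    fix e' assume "e' \<in> ?S x y"
    then obtain i where i: "i < m" "e' = edge x y i" by auto
    then show "e' \<in> {e \<in> edges G. f e \<noteq> 0}"
      using even_deg_const[OF f that(1-3) i(1)] edge_in[OF that(1-3) i(1)] that(4) by simp
  qed
  have card_S: "card (?S x y) = m" if "x \<in> B" "y \<in> B" "x \<noteq> y" for x y
    using inj[OF that] by (simp add: card_image)
  have d1: "?S u v \<inter> ?S u w = {}" by (rule disj) (use uv(1-3) w(1-3) in auto)
  have d2: "?S u v \<inter> ?S v w' = {}" by (rule disj) (use uv(1-3) w'(1-3) in auto)
  have d3: "?S u w \<inter> ?S v w' = {}" by (rule disj) (use uv(1-3) w(1-3) w'(1-3) in auto)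
  have "card (?S u v \<union> ?S u w \<union> ?S v w') = card (?S u v \<union> ?S u w) + card (?S v w')"
    using d2 d3 by (intro card_Un_disjoint) auto
  also have "card (?S u v \<union> ?S u w) = card (?S u v) + card (?S u w)"
    using d1 by (intro card_Un_disjoint) auto
  finally have "card (?S u v \<union> ?S u w \<union> ?S v w') = 3 * m"
    using card_S[of u v] card_S[of u w] card_S[of v w'] uv(1-3) w(1-3) w'(1-3) by simp
  moreover have le: "?S u v \<union> ?S u w \<union> ?S v w' \<subseteq> {e \<in> edges G. f e \<noteq> 0}"
    using uv(1-3) w w' nz' by (intro Un_least sub) auto
  moreover have "finite {e \<in> edges G. f e \<noteq> 0}" using finite_edges by simp
  ultimately show ?thesis using card_mono[OF _ le] by simp
qed

lemma cycle_length_ge: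
  assumes c: "is_cycle G c"
  shows "3 * m \<le> length c"
proof -
  have ne: "c \<noteq> []" using c by (auto simp: is_cycle_def)
  have img: "cycle_edges c = (\<lambda>i. {c ! i, c ! (Suc i mod length c)}) ` {..<length c}"
    by (rule cycle_edges_nth[OF ne])
  have "indicator (cycle_edges c) \<noteq> (0 :: 'a set \<Rightarrow> bit)"
  proof
    assume "indicator (cycle_edges c) = (0 :: 'a set \<Rightarrow> bit)"
    then have "indicator (cycle_edges c) {last c, hd c} = (0 :: bit)" by simp
    then show False by (simp add: cycle_edges_def)
  qed
  then have "3 * m \<le> card {e \<in> edges G. indicator (cycle_edges c) e \<noteq> (0 :: bit)}"
    by (rule even_deg_support_card[OF even_deg_cycle[OF c]])
  also have "\<dots> \<le> card (cycle_edges c)"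
  proof (rule card_mono)
    show "finite (cycle_edges c)" unfolding img by simp
    show "{e \<in> edges G. indicator (cycle_edges c) e \<noteq> (0 :: bit)} \<subseteq> cycle_edges c"
      by (auto simp: indicator_def)
  qed
  also have "\<dots> \<le> length c" unfolding img using card_image_le[of "{..<length c}"] by simp
  finally show ?thesis .
qed

definition tri :: "'a \<Rightarrow> 'a \<Rightarrow> 'a \<Rightarrow> nat \<Rightarrow> 'a" where
  "tri r u v i = (if i < m then q r u i else if i < 2 * m then q u v (i - m) else q v r (i - 2 * m))"

definition triangle :: "'a \<Rightarrow> 'a \<Rightarrow> 'a \<Rightarrow> 'a list" where
  "triangle r u v = map (tri r u v) [0..<3 * m]"

lemma triangle_edges:
  assumes B: "r \<in> B" "u \<in> B" "v \<in> B" and d: "r \<noteq> u" "u \<noteq> v" "v \<noteq> r"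
  shows "cycle_edges (triangle r u v) =
    edge r u ` {..<m} \<union> edge u v ` {..<m} \<union> edge v r ` {..<m}"
proof -
  let ?e = "\<lambda>i. {tri r u v i, tri r u v (Suc i mod (3 * m))}"
  have 1: "?e i = edge r u i" if "i < m" for i
  proof (cases "Suc i = m")
    case True
    then show ?thesis using that m_pos q_0[of u v] q_m[of r u] assms by (auto simp: tri_def edge_def)
  qed (use that in \<open>auto simp: tri_def edge_def\<close>)
  have 2: "?e (m + i) = edge u v i" if "i < m" for i
  proof (cases "Suc i = m")
    case True
    then have "Suc (m + i) = 2 * m" by simp
    then show ?thesis using that m_pos q_0[of v r] q_m[of u v] assms True
      by (auto simp: tri_def edge_def)
  qed (use that in \<open>auto simp: tri_def edge_def\<close>)
  have 3: "?e (2 * m + i) = edge v r i" if "i < m" for i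
  proof (cases "Suc i = m")
    case True
    then have "Suc (2 * m + i) = 3 * m" by simp
    then have "Suc (2 * m + i) mod (3 * m) = 0" by (metis mod_self)
    moreover have "tri r u v 0 = q v r (Suc i)"
      using True m_pos q_0[of r u] q_m[of v r] assms by (simp add: tri_def)
    moreover have "tri r u v (2 * m + i) = q v r i" by (simp add: tri_def)
    ultimately show ?thesis by (simp add: edge_def)
  qed (use that in \<open>auto simp: tri_def edge_def\<close>)
  have "{..<3 * m} = {..<m} \<union> (+) m ` {..<m} \<union> (+) (2 * m) ` {..<m}"
  proof (intro set_eqI iffI)
    fix i assume "i \<in> {..<3 * m}"
    then consider "i < m" | "i - m \<in> {..<m}" "i = m + (i - m)"
      | "i - 2 * m \<in> {..<m}" "i = 2 * m + (i - 2 * m)" by force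
    then show "i \<in> {..<m} \<union> (+) m ` {..<m} \<union> (+) (2 * m) ` {..<m}" by cases blast+
  qed auto
  moreover have "?e ` {..<m} = edge r u ` {..<m}" using 1 by (intro image_cong) auto
  moreover have "?e ` (+) m ` {..<m} = edge u v ` {..<m}"
    unfolding image_image using 2 by (intro image_cong) auto
  moreover have "?e ` (+) (2 * m) ` {..<m} = edge v r ` {..<m}"
    unfolding image_image using 3 by (intro image_cong) auto
  ultimately have e: "?e ` {..<3 * m} = edge r u ` {..<m} \<union> edge u v ` {..<m} \<union> edge v r ` {..<m}"
    by (simp only: image_Un)
  have "cycle_edges (triangle r u v) = ?e ` {..<3 * m}"
    using m_pos by (subst cycle_edges_nth) (auto simp: triangle_def intro!: image_cong)
  then show ?thesis using e by simp
qed

lemma triangle_cycle: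
  assumes B: "r \<in> B" "u \<in> B" "v \<in> B" and d: "r \<noteq> u" "u \<noteq> v" "v \<noteq> r"
  shows "is_cycle G (triangle r u v)"
  unfolding is_cycle_def
proof (intro conjI)
  show "3 \<le> length (triangle r u v)" using m_pos by (simp add: triangle_def)
  have val: "\<exists>x y k. tri r u v i = q x y k \<and> k < m \<and>
      (x = r \<and> y = u \<and> i = k \<or> x = u \<and> y = v \<and> i = m + k \<or> x = v \<and> y = r \<and> i = 2 * m + k)"
    if "i < 3 * m" for i
  proof -
    consider "i < m" | "\<not> i < m" "i < 2 * m" | "\<not> i < 2 * m" by linarith
    then show ?thesis
    proof cases
      case 1 then show ?thesis by (intro exI[of _ r] exI[of _ u] exI[of _ i]) (auto simp: tri_def)
    next
      case 2 then show ?thesis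
        by (intro exI[of _ u] exI[of _ v] exI[of _ "i - m"]) (auto simp: tri_def)
    next
      case 3 then show ?thesis using that
        by (intro exI[of _ v] exI[of _ r] exI[of _ "i - 2 * m"]) (auto simp: tri_def)
    qed
  qed
  have uniq: "k = k' \<and> x = x'" if "x \<in> B" "y \<in> B" "x \<noteq> y" "x' \<in> B" "y' \<in> B" "x' \<noteq> y'"
    "k < m" "k' < m" "q x y k = q x' y' k'" "\<not> (x' = y \<and> y' = x)" for x y x' y' k k'
  proof (cases "k = 0")
    case True
    then have "q x' y' k' \<in> B" using that q_0[of x y] by auto
    then have "k' = 0" using q_in_B_iff[of x' y' k'] that by auto
    then show ?thesis using True that q_0[of x y] q_0[of x' y'] by auto
  next
    case False
    then show ?thesis using q_inner[of x y x' y' k k'] that by auto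
  qed
  have "inj_on (tri r u v) {0..<3 * m}"
  proof (rule inj_onI)
    fix i j assume ij: "i \<in> {0..<3 * m}" "j \<in> {0..<3 * m}" "tri r u v i = tri r u v j"
    obtain x y k where x: "tri r u v i = q x y k" "k < m"
      "x = r \<and> y = u \<and> i = k \<or> x = u \<and> y = v \<and> i = m + k \<or> x = v \<and> y = r \<and> i = 2 * m + k"
      using val[of i] ij by auto
    obtain x' y' k' where x': "tri r u v j = q x' y' k'" "k' < m"
      "x' = r \<and> y' = u \<and> j = k' \<or> x' = u \<and> y' = v \<and> j = m + k' \<or> x' = v \<and> y' = r \<and> j = 2 * m + k'"
      using val[of j] ij by auto
    have "k = k' \<and> x = x'"
    proof (rule uniq)
      show "x \<in> B" "y \<in> B" "x \<noteq> y" "x' \<in> B" "y' \<in> B" "x' \<noteq> y'" "k < m" "k' < m"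
        using x x' B d by auto
      show "q x y k = q x' y' k'" using x x' ij by simp
      show "\<not> (x' = y \<and> y' = x)" using x(3) x'(3) d by auto
    qed
    then show "i = j" using x(3) x'(3) d by auto
  qed
  then show "distinct (triangle r u v)" by (simp add: triangle_def distinct_map)
  show "set (triangle r u v) \<subseteq> verts G"
  proof
    fix z assume "z \<in> set (triangle r u v)"
    then obtain i where i: "i < 3 * m" "z = tri r u v i" by (auto simp: triangle_def)
    obtain x y k where x: "tri r u v i = q x y k" "k < m"
      "x = r \<and> y = u \<and> i = k \<or> x = u \<and> y = v \<and> i = m + k \<or> x = v \<and> y = r \<and> i = 2 * m + k"
      using val[OF i(1)] by blast
    then have "x \<in> B" "y \<in> B" "x \<noteq> y" "k \<le> m" "z = q x y k" using B d i by auto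
    then show "z \<in> verts G" unfolding verts_G by blast
  qed
  show "cycle_edges (triangle r u v) \<subseteq> edges G"
    unfolding triangle_edges[OF assms] using edge_in assms by auto
qed

abbreviation short_cycles :: "('a set \<Rightarrow> bit) set" where
  "short_cycles \<equiv> {indicator (cycle_edges c) |c. is_cycle G c \<and> length c \<le> 3 * m}"

lemma triangle_short:
  assumes "r \<in> B" "u \<in> B" "v \<in> B" "r \<noteq> u" "u \<noteq> v" "v \<noteq> r"
  shows "indicator (cycle_edges (triangle r u v)) \<in> short_cycles"
proof -
  have "length (triangle r u v) \<le> 3 * m" by (simp add: triangle_def)
  then show ?thesis using triangle_cycle[OF assms] by blast
qed

text \<open>As in the complete graph, the triangles through a fixed branch vertex \<open>r\<close> generate. Adding the
  triangle \<open>r u v\<close> removes the subdivided edge between \<open>u\<close> and \<open>v\<close> and changes no other one that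
  avoids \<open>r\<close>. Once all subdivided edges avoiding \<open>r\<close> are gone, each further branch vertex is
  incident with at most one used subdivided edge, hence by parity with none.\<close>

lemma even_deg_in_span:
  assumes r: "r \<in> B"
  shows "even_deg f \<Longrightarrow> f \<in> edge_space.span short_cycles"
proof (induction "card {(u, v). u \<in> B - {r} \<and> v \<in> B - {r} \<and> u \<noteq> v \<and> f (edge u v 0) \<noteq> 0}"
    arbitrary: f rule: less_induct)
  case less
  let ?D = "\<lambda>f. {(u, v). u \<in> B - {r} \<and> v \<in> B - {r} \<and> u \<noteq> v \<and> f (edge u v 0) \<noteq> (0::bit)}"
  have fin: "finite (?D f)"
    by (rule finite_subset[of _ "B \<times> B"]) (use finite_B in auto)
  show ?case
  proof (cases "?D f = {}")
    case True
    have "f = 0"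
    proof (rule ccontr)
      assume "f \<noteq> 0"
      then obtain e where "f e \<noteq> 0" by (auto simp: fun_eq_iff)
      then have "e \<in> edges G" using less.prems by (auto simp: even_deg_def)
      then obtain u v i where uv: "u \<in> B" "v \<in> B" "u \<noteq> v" "i < m" "e = edge u v i"
        unfolding edges_G' by blast
      have "f (edge u v 0) \<noteq> 0"
        using \<open>f e \<noteq> 0\<close> even_deg_const[OF less.prems uv(1-4)] uv(5) by simp
      moreover from this have "f (edge v u 0) \<noteq> 0"
        using even_deg_sym[OF less.prems uv(1-3)] by simp
      ultimately obtain x y where xy: "x \<in> B" "y \<in> B" "x \<noteq> y" "x \<noteq> r" "f (edge x y 0) \<noteq> 0"
        using uv by metis
      then obtain w where "w \<in> B" "w \<noteq> x" "w \<noteq> y" "f (edge x w 0) \<noteq> 0"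
        using even_deg_second[OF less.prems] by metis
      then have "(x, y) \<in> ?D f \<or> (x, w) \<in> ?D f" using xy by auto
      then show False using True by blast
    qed
    then show ?thesis by (simp add: edge_space.span_zero)
  next
    case False
    then obtain u v where uv: "u \<in> B" "v \<in> B" "u \<noteq> v" "u \<noteq> r" "v \<noteq> r" "f (edge u v 0) \<noteq> 0"
      by auto
    then have tri: "r \<in> B" "u \<in> B" "v \<in> B" "r \<noteq> u" "u \<noteq> v" "v \<noteq> r" using r by auto
    define t :: "'a set \<Rightarrow> bit" where "t = indicator (cycle_edges (triangle r u v))"
    have t_ev: "even_deg t" unfolding t_def by (rule even_deg_cycle[OF triangle_cycle[OF tri]])
    have t_val: "t (edge x y 0) = (if {x, y} = {u, v} then 1 else 0)"
      if "x \<in> B - {r}" "y \<in> B - {r}" "x \<noteq> y" for x y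
    proof -
      have "edge x y 0 \<notin> edge r u ` {..<m}" "edge x y 0 \<notin> edge v r ` {..<m}"
        using edge_eqD[of x y r u 0] edge_eqD[of x y v r 0] that tri m_pos by auto
      moreover have "edge x y 0 \<in> edge u v ` {..<m} \<longleftrightarrow> {x, y} = {u, v}"
      proof
        assume "edge x y 0 \<in> edge u v ` {..<m}"
        then show "{x, y} = {u, v}" using edge_eqD[of x y u v 0] that tri m_pos by auto
      next
        assume "{x, y} = {u, v}"
        then show "edge x y 0 \<in> edge u v ` {..<m}"
          using edge_rev[of u v 0] tri m_pos by (auto simp: doubleton_eq_iff)
      qed
      ultimately show ?thesis unfolding t_def triangle_edges[OF tri] by (simp add: indicator_def)
    qed
    have uv0: "f (edge v u 0) \<noteq> 0" using even_deg_sym[OF less.prems, of u v] uv by auto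
    have sub: "?D (f + t) \<subseteq> ?D f"
      using t_val uv uv0 by (auto simp: doubleton_eq_iff split: if_splits)
    moreover have "(u, v) \<in> ?D f" using uv by auto
    moreover have "f (edge u v 0) = 1" using uv by auto
    then have "(u, v) \<notin> ?D (f + t)" using t_val[of u v] uv by simp
    ultimately have "?D (f + t) \<subset> ?D f" by blast
    then have "card (?D (f + t)) < card (?D f)" by (rule psubset_card_mono[OF fin])
    then have "f + t \<in> edge_space.span short_cycles"
      using less.hyps even_deg_add[OF less.prems t_ev] by blast
    moreover have "t \<in> edge_space.span short_cycles"
      unfolding t_def by (rule edge_space.span_base[OF triangle_short[OF tri]])
    ultimately have "f + t + t \<in> edge_space.span short_cycles" by (rule edge_space.span_add)
    moreover have "f + t + t = f" by (rule ext) (simp add: add.assoc)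
    ultimately show ?thesis by simp
  qed
qed

lemma ex_triangle: "\<exists>r u v. r \<in> B \<and> u \<in> B \<and> v \<in> B \<and> r \<noteq> u \<and> u \<noteq> v \<and> v \<noteq> r"
  by (metis ex_other)

theorem ell_eq: "ell G = 3 * m"
  unfolding ell_def
proof (rule Least_equality)
  obtain r where r: "r \<in> B" using ex_triangle by blast
  have "cycle_space G \<subseteq> edge_space.span short_cycles"
    unfolding cycle_space_def
    by (rule edge_space.span_minimal)
      (use even_deg_in_span[OF r] even_deg_cycle in \<open>auto intro: edge_space.subspace_span\<close>)
  moreover have "edge_space.span short_cycles \<subseteq> cycle_space G"
    unfolding cycle_space_def by (rule edge_space.span_mono) auto
  ultimately show "short_cycles_generate G (3 * m)"
    by (auto simp: short_cycles_generate_def)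
next
  fix l assume l: "short_cycles_generate G l"
  show "3 * m \<le> l"
  proof (rule ccontr)
    assume "\<not> 3 * m \<le> l"
    then have none: "{indicator (cycle_edges c) |c. is_cycle G c \<and> length c \<le> l} = ({} :: ('a set \<Rightarrow> bit) set)"
      using cycle_length_ge by fastforce
    then have triv: "cycle_space G = {0}"
      using l unfolding short_cycles_generate_def none edge_space.span_empty by simp
    obtain r u v where c: "is_cycle G (triangle r u v)" using ex_triangle triangle_cycle by metis
    then have "indicator (cycle_edges (triangle r u v)) \<in> cycle_space G"
      unfolding cycle_space_def by (intro edge_space.span_base) blast
    then have "indicator (cycle_edges (triangle r u v)) = (0 :: 'a set \<Rightarrow> bit)" using triv by simp
    then have "indicator (cycle_edges (triangle r u v))
        {last (triangle r u v), hd (triangle r u v)} = (0 :: bit)" by simp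
    then show False by (simp add: cycle_edges_def)
  qed
qed


section \<open>Tree-width\<close>

definition inner :: "'a \<Rightarrow> 'a \<Rightarrow> 'a set" where
  "inner u v = q u v ` {0<..<m}"

lemma inner_sym:
  assumes "u \<in> B" "v \<in> B" "u \<noteq> v"
  shows "inner v u = inner u v"
proof -
  have "q v u ` {0<..<m} = (\<lambda>i. q u v (m - i)) ` {0<..<m}"
    using q_rev[OF assms] by (intro image_cong) auto
  also have "\<dots> = q u v ` (\<lambda>i. m - i) ` {0<..<m}" by (simp add: image_image)
  also have "(\<lambda>i. m - i) ` {0<..<m} = {0<..<m}"
  proof (intro set_eqI iffI)
    fix i assume "i \<in> {0<..<m}"
    then have "m - (m - i) = i" "m - i \<in> {0<..<m}" by auto
    then show "i \<in> (\<lambda>i. m - i) ` {0<..<m}" by (metis imageI)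
  qed auto
  finally show ?thesis by (simp add: inner_def)
qed

lemma q_in_verts: "\<lbrakk>u \<in> B; v \<in> B; u \<noteq> v; i \<le> m\<rbrakk> \<Longrightarrow> q u v i \<in> verts G"
  unfolding verts_G by blast

lemma inner_disjoint:
  assumes "u \<in> B" "v \<in> B" "u \<noteq> v" "x \<in> B" "y \<in> B" "x \<noteq> y"
    and "\<not> (x = u \<and> y = v)" "\<not> (x = v \<and> y = u)"
  shows "inner u v \<inter> inner x y = {}"
proof -
  have "q u v i \<noteq> q x y j" if "0 < i" "i < m" "j < m" for i j
    using q_inner[OF assms(1-6) that(1,2), of j] that assms by auto
  then show ?thesis by (auto simp: inner_def)
qed

lemma inner_not_B: "\<lbrakk>u \<in> B; v \<in> B; u \<noteq> v\<rbrakk> \<Longrightarrow> inner u v \<inter> B = {}"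
  using inner_notin_B by (auto simp: inner_def)

lemma q_segment: "\<lbrakk>u \<in> B; v \<in> B; u \<noteq> v\<rbrakk> \<Longrightarrow> q u v ` {..m} = insert u (insert v (inner u v))"
proof -
  assume uv: "u \<in> B" "v \<in> B" "u \<noteq> v"
  have "{..m} = insert 0 (insert m {0<..<m})" by auto
  then show ?thesis using q_0[OF uv] q_m[OF uv] by (simp add: inner_def)
qed

lemma segment_reach:
  assumes uv: "u \<in> B" "v \<in> B" "u \<noteq> v" and "i \<le> j" "j \<le> m"
    and U: "\<And>l. i \<le> l \<Longrightarrow> l \<le> j \<Longrightarrow> q u v l \<in> U"
  shows "(q u v i, q u v j) \<in> (adj_in G U)\<^sup>*"
  using assms(4,5) U
proof (induction j rule: dec_induct)
  case (step j)
  have "(q u v i, q u v j) \<in> (adj_in G U)\<^sup>*" using step by auto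
  moreover have "(q u v j, q u v (Suc j)) \<in> adj_in G U"
    using step edge_in[OF uv, of j] by (auto simp: adj_in_def edge_def)
  ultimately show ?case by auto
qed simp

text \<open>The vertex sets used below are mostly unions of initial segments of subdivided edges at one
  branch vertex.\<close>

lemma star_connected:
  assumes r: "r \<in> B" "r \<in> U" and U: "U \<subseteq> verts G"
    and star: "\<And>x. x \<in> U \<Longrightarrow>
      \<exists>v i. v \<in> B \<and> v \<noteq> r \<and> i \<le> m \<and> x = q r v i \<and> (\<forall>j\<le>i. q r v j \<in> U)"
  shows "connected_graph (induced_subgraph G U)"
proof (rule connected_via_root[OF r(2) U])
  fix x assume "x \<in> U"
  then obtain v i where v: "v \<in> B" "v \<noteq> r" "i \<le> m" "x = q r v i" "\<forall>j\<le>i. q r v j \<in> U"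
    using star by blast
  have "(q r v 0, q r v i) \<in> (adj_in G U)\<^sup>*"
    using v r by (intro segment_reach) auto
  then show "(r, x) \<in> (adj_in G U)\<^sup>*" using v r q_0[of r v] by simp
qed

text \<open>A subdivided edge is attached to the part \<open>B\<close> by a path of parts \<open>{u, q u v j, q u v (j + 1)}\<close>,
  starting at the end \<open>v\<close>. Keeping \<open>u\<close> in all of them lets the last one close up at \<open>u\<close>.\<close>

lemma bag_tree_add_segment:
  assumes uv: "u \<in> B" "v \<in> B" "u \<noteq> v"
    and \<V>: "bag_tree \<V>" "B \<in> \<V>" "inner u v \<inter> \<Union>\<V> = {}"
  shows "j \<le> m \<Longrightarrow> \<exists>\<W>. bag_tree (\<V> \<union> \<W>) \<and> \<Union>(\<V> \<union> \<W>) = \<Union>\<V> \<union> q u v ` {j..<m} \<and>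
    (\<exists>A\<in>\<V> \<union> \<W>. u \<in> A \<and> q u v j \<in> A) \<and> (\<forall>A\<in>\<W>. card A \<le> 3) \<and>
    (\<forall>i. j \<le> i \<and> i < m \<longrightarrow> (\<exists>A\<in>\<W>. edge u v i \<subseteq> A))"
proof (induction j rule: inc_induct)
  case base
  have "\<exists>A\<in>\<V>. u \<in> A \<and> q u v m \<in> A" using \<V> uv q_m[OF uv] by auto
  then show ?case using \<V>(1) by (intro exI[of _ "{}"]) auto
next
  case (step j)
  obtain \<W> where W': "bag_tree (\<V> \<union> \<W>) \<and> \<Union>(\<V> \<union> \<W>) = \<Union>\<V> \<union> q u v ` {Suc j..<m} \<and>
    (\<exists>A\<in>\<V> \<union> \<W>. u \<in> A \<and> q u v (Suc j) \<in> A) \<and> (\<forall>A\<in>\<W>. card A \<le> 3) \<and>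
    (\<forall>i. Suc j \<le> i \<and> i < m \<longrightarrow> (\<exists>A\<in>\<W>. edge u v i \<subseteq> A))"
    using step.IH by (rule exE)
  then obtain A where A: "A \<in> \<V> \<union> \<W>" "u \<in> A" "q u v (Suc j) \<in> A" by blast
  have W: "bag_tree (\<V> \<union> \<W>)" "\<Union>(\<V> \<union> \<W>) = \<Union>\<V> \<union> q u v ` {Suc j..<m}" "\<forall>A\<in>\<W>. card A \<le> 3"
    "\<forall>i. Suc j \<le> i \<and> i < m \<longrightarrow> (\<exists>A\<in>\<W>. edge u v i \<subseteq> A)" using W' by simp_all
  define N where "N = {u, q u v j, q u v (Suc j)}"
  have "q u v j \<in> A" if "q u v j \<in> \<Union>(\<V> \<union> \<W>)"
  proof (cases "j = 0")
    case True
    then show ?thesis using A(2) q_0[OF uv] by simp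
  next
    case False
    then have "q u v j \<in> inner u v" using step.hyps by (auto simp: inner_def)
    then have "q u v j \<in> q u v ` {Suc j..<m}" using that W(2) \<V>(3) by blast
    then obtain l where "Suc j \<le> l" "l < m" "q u v j = q u v l" by auto
    then show ?thesis using q_inj[OF uv, of j l] step.hyps by simp
  qed
  then have "N \<inter> \<Union>(\<V> \<union> \<W>) \<subseteq> A" using A(2,3) by (auto simp: N_def)
  then have "bag_tree (insert N (\<V> \<union> \<W>))" by (rule bag_tree.leaf[OF W(1) A(1)])
  moreover have "\<Union>(insert N (\<V> \<union> \<W>)) = \<Union>\<V> \<union> q u v ` {j..<m}"
  proof -
    have "u \<in> \<Union>\<V>" "v \<in> \<Union>\<V>" using uv \<V>(2) by auto
    moreover have "q u v (Suc j) = v \<or> q u v (Suc j) \<in> q u v ` {Suc j..<m}"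
      using step.hyps q_m[OF uv] by (cases "Suc j = m") auto
    moreover have "{j..<m} = insert j {Suc j..<m}" using step.hyps by auto
    ultimately show ?thesis using W(2) unfolding N_def by auto
  qed
  moreover have "card N \<le> 3" unfolding N_def by (simp add: card_insert_if)
  moreover have "edge u v j \<subseteq> N" by (auto simp: edge_def N_def)
  then have "\<forall>i. j \<le> i \<and> i < m \<longrightarrow> (\<exists>A\<in>insert N \<W>. edge u v i \<subseteq> A)"
    using W(4) by (metis insertCI le_antisym not_less_eq_eq)
  ultimately show ?case using W(3)
    by (intro exI[of _ "insert N \<W>"]) (auto simp: N_def)
qed

text \<open>The pairs in \<open>D\<close> are ordered; adding \<open>(u, v)\<close> after \<open>(v, u)\<close> changes nothing.\<close>

lemma bag_tree_segments:
  assumes "finite D" "D \<subseteq> {(u, v). u \<in> B \<and> v \<in> B \<and> u \<noteq> v}"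
  shows "\<exists>\<V>. bag_tree \<V> \<and> B \<in> \<V> \<and> \<Union>\<V> = B \<union> (\<Union>(u, v)\<in>D. inner u v) \<and>
    (\<forall>A\<in>\<V>. card A \<le> card B) \<and> (\<forall>(u, v)\<in>D. \<forall>i<m. \<exists>A\<in>\<V>. edge u v i \<subseteq> A)"
  using assms
proof (induction D rule: finite_induct)
  case empty
  show ?case by (intro exI[of _ "{B}"]) (auto intro: bag_tree.single)
next
  case (insert d D)
  obtain u v where d: "d = (u, v)" by (cases d)
  have uv: "u \<in> B" "v \<in> B" "u \<noteq> v" using insert.prems d by auto
  have "D \<subseteq> {(u, v). u \<in> B \<and> v \<in> B \<and> u \<noteq> v}" using insert.prems by simp
  then obtain \<V> where V': "bag_tree \<V> \<and> B \<in> \<V> \<and> \<Union>\<V> = B \<union> (\<Union>(u, v)\<in>D. inner u v) \<and>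
    (\<forall>A\<in>\<V>. card A \<le> card B) \<and> (\<forall>(u, v)\<in>D. \<forall>i<m. \<exists>A\<in>\<V>. edge u v i \<subseteq> A)"
    using insert.IH by (elim meta_impE exE)
  then have V: "bag_tree \<V>" "B \<in> \<V>" "\<Union>\<V> = B \<union> (\<Union>(u, v)\<in>D. inner u v)"
    "\<forall>A\<in>\<V>. card A \<le> card B" "\<And>x y i. (x, y) \<in> D \<Longrightarrow> i < m \<Longrightarrow> \<exists>A\<in>\<V>. edge x y i \<subseteq> A"
    by blast+
  show ?case
  proof (cases "(v, u) \<in> D")
    case True
    then have "inner u v \<subseteq> \<Union>\<V>" using V(3) inner_sym[OF uv] by auto
    then have "\<Union>\<V> = B \<union> (\<Union>(u, v)\<in>insert d D. inner u v)" using V(3) d by auto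
    moreover have "\<exists>A\<in>\<V>. edge u v i \<subseteq> A" if "i < m" for i
      using V(5)[OF True, of "m - Suc i"] edge_rev[of v u i] uv that by auto
    ultimately show ?thesis using V d by (intro exI[of _ \<V>]) auto
  next
    case False
    have "inner u v \<inter> inner x y = {}" if "(x, y) \<in> D" for x y
      using inner_disjoint[OF uv, of x y] False that insert.hyps insert.prems d by auto
    then have "inner u v \<inter> \<Union>\<V> = {}" using V(3) inner_not_B[OF uv] by blast
    from bag_tree_add_segment[OF uv V(1,2) this, of 0]
    obtain \<W> where W: "bag_tree (\<V> \<union> \<W>)" "\<Union>(\<V> \<union> \<W>) = \<Union>\<V> \<union> q u v ` {0..<m}"
      "\<forall>A\<in>\<W>. card A \<le> 3" "\<And>i. i < m \<Longrightarrow> \<exists>A\<in>\<W>. edge u v i \<subseteq> A" by auto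
    have "{0..<m} = insert 0 {0<..<m}" using m_pos by auto
    then have "\<Union>\<V> \<union> q u v ` {0..<m} = \<Union>\<V> \<union> inner u v"
      using q_0[OF uv] uv V(2) by (auto simp: inner_def)
    then have "\<Union>(\<V> \<union> \<W>) = B \<union> (\<Union>(u, v)\<in>insert d D. inner u v)"
      using W(2) V(3) d by auto
    moreover have "\<forall>A\<in>\<V> \<union> \<W>. card A \<le> card B"
    proof
      fix A assume "A \<in> \<V> \<union> \<W>"
      then show "card A \<le> card B"
      proof
        assume "A \<in> \<W>"
        then have "card A \<le> 3" using W(3) by blast
        then show ?thesis using card_B by linarith
      qed (use V(4) in blast)
    qed
    moreover have "\<forall>(x, y)\<in>insert d D. \<forall>i<m. \<exists>A\<in>\<V> \<union> \<W>. edge x y i \<subseteq> A"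
    proof (intro ballI, clarify)
      fix x y i assume xy: "(x, y) \<in> insert d D" and i: "i < m"
      show "\<exists>A\<in>\<V> \<union> \<W>. edge x y i \<subseteq> A"
      proof (cases "(x, y) \<in> D")
        case True
        then show ?thesis using V(5)[OF True i] by auto
      next
        case False
        then have "x = u" "y = v" using xy d by auto
        then show ?thesis using W(4)[OF i] by auto
      qed
    qed
    moreover have "B \<in> \<V> \<union> \<W>" using V(2) by (rule UnI1)
    ultimately show ?thesis
      using W(1) by (intro exI[of _ "\<V> \<union> \<W>"] conjI)
  qed
qed

lemma narrow_tree_decomposition:
  "\<exists>(T :: nat sgraph) V. tree_decomposition G T V \<and> width T V \<le> card B - 1"
proof -
  let ?D = "{(u, v). u \<in> B \<and> v \<in> B \<and> u \<noteq> v}"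
  have "finite ?D" by (rule finite_subset[of _ "B \<times> B"]) (use finite_B in auto)
  then obtain \<V> where V: "bag_tree \<V>" "\<Union>\<V> = B \<union> (\<Union>(u, v)\<in>?D. inner u v)"
    "\<forall>A\<in>\<V>. card A \<le> card B" "\<forall>(u, v)\<in>?D. \<forall>i<m. \<exists>A\<in>\<V>. edge u v i \<subseteq> A"
    using bag_tree_segments[of ?D] by auto
  have "verts G = \<Union>\<V>"
  proof
    show "verts G \<subseteq> \<Union>\<V>"
    proof
      fix x assume "x \<in> verts G"
      then obtain u v i where x: "u \<in> B" "v \<in> B" "u \<noteq> v" "i \<le> m" "x = q u v i"
        unfolding verts_G by blast
      then have "x \<in> q u v ` {..m}" by blast
      then have "x \<in> insert u (insert v (inner u v))" by (simp only: q_segment[OF x(1-3)])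
      then show "x \<in> \<Union>\<V>" unfolding V(2) using x(1-3) by blast
    qed
    have "inner u v \<subseteq> verts G" if "(u, v) \<in> ?D" for u v
      using that q_in_verts by (auto simp: inner_def)
    then show "\<Union>\<V> \<subseteq> verts G" unfolding V(2) using B_subset_verts by blast
  qed
  moreover have "\<exists>A\<in>\<V>. e \<subseteq> A" if "e \<in> edges G" for e
    using that V(4) unfolding edges_G' by blast
  ultimately obtain T :: "nat sgraph" and W where T: "tree_decomposition G T W" "W ` verts T = \<V>"
    using tree_decomposition_of_bag_tree[OF V(1)] by metis
  have "width T W \<le> card B - 1"
    unfolding width_le_iff[OF T(1)] T(2) using V(3) diff_le_mono by blast
  then show ?thesis using T(1) by blast
qed

text \<open>The complete graph is a minor: its branch sets \<open>U v\<close> are disjoint, connected and touch pairwise,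
  so a part meeting all of them has at least \<open>card B\<close> vertices. Numbering the branch vertices by
  \<open>h\<close> decides to which of its ends the interior of a subdivided edge belongs.\<close>

lemma tree_decomposition_width_ge:
  assumes td: "tree_decomposition G T V"
  shows "card B - 1 \<le> width T V"
proof -
  obtain h :: "'a \<Rightarrow> nat" where h: "inj_on h B"
    using finite_imp_inj_to_nat_seg[OF finite_B] by blast
  define U where "U v = {q v w i |w i. w \<in> B \<and> w \<noteq> v \<and> i < m \<and> (i = 0 \<or> h v < h w)}" for v
  have root: "v \<in> U v" if "v \<in> B" for v
  proof -
    obtain w where "w \<in> B" "w \<noteq> v" using ex_other by blast
    then show ?thesis using q_0[of v w] m_pos that unfolding U_def by force
  qed
  have sub: "U v \<subseteq> verts G" if "v \<in> B" for v
    using that q_in_verts unfolding U_def by fastforce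
  have con: "connected_graph (induced_subgraph G (U v))" if v: "v \<in> B" for v
  proof (rule star_connected[OF v root[OF v] sub[OF v]])
    fix x assume "x \<in> U v"
    then obtain w i where w: "w \<in> B" "w \<noteq> v" "i < m" "i = 0 \<or> h v < h w" "x = q v w i"
      unfolding U_def by blast
    then have "\<forall>j\<le>i. q v w j \<in> U v" unfolding U_def by fastforce
    then show "\<exists>w i. w \<in> B \<and> w \<noteq> v \<and> i \<le> m \<and> x = q v w i \<and> (\<forall>j\<le>i. q v w j \<in> U v)"
      using w less_imp_le by blast
  qed
  have touch1: "\<exists>x\<in>U u. \<exists>y\<in>U v. {x, y} \<in> edges G" if uv: "u \<in> B" "v \<in> B" "h u < h v" for u v
  proof -
    have "u \<noteq> v" using uv by auto
    then have "m - 1 < m" "v \<noteq> u" using m_pos by auto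
    then have "q u v (m - 1) \<in> U u" unfolding U_def using uv by blast
    moreover have "edge u v (m - 1) \<in> edges G" by (rule edge_in) (use uv m_pos in auto)
    moreover have "edge u v (m - 1) = {q u v (m - 1), v}"
      using q_m[OF uv(1,2) \<open>u \<noteq> v\<close>] m_pos by (simp add: edge_def)
    ultimately show ?thesis using root[OF uv(2)] by auto
  qed
  have touch: "U u \<inter> U v \<noteq> {} \<or> (\<exists>x\<in>U u. \<exists>y\<in>U v. {x, y} \<in> edges G)"
    if uv: "u \<in> B" "v \<in> B" for u v
  proof (cases "u = v")
    case True
    then show ?thesis using root uv by blast
  next
    case False
    then have "h u \<noteq> h v" using h uv by (auto simp: inj_on_def)
    then consider "h u < h v" | "h v < h u" by linarith
    then show ?thesis
    proof cases
      case 1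
      then show ?thesis using touch1 uv by blast
    next
      case 2
      then show ?thesis using touch1[OF uv(2,1)] by (metis insert_commute)
    qed
  qed
  have disj: "u = v" if uv: "u \<in> B" "v \<in> B" "x \<in> U u" "x \<in> U v" for u v x
  proof -
    obtain w i where w: "w \<in> B" "w \<noteq> u" "i < m" "i = 0 \<or> h u < h w" "x = q u w i"
      using uv(3) unfolding U_def by blast
    obtain w' j where w': "w' \<in> B" "w' \<noteq> v" "j < m" "j = 0 \<or> h v < h w'" "x = q v w' j"
      using uv(4) unfolding U_def by blast
    show ?thesis
    proof (cases "i = 0")
      case True
      then have "x = u" using w q_0[of u w] uv by auto
      then have "j = 0" using q_in_B_iff[of v w' j] w' uv by auto
      then show ?thesis using \<open>x = u\<close> w' q_0[of v w'] uv by auto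
    next
      case False
      have "v = u \<and> w' = w \<and> j = i \<or> v = w \<and> w' = u \<and> j = m - i"
        by (rule q_inner) (use w w' uv False in auto)
      then show ?thesis using w(4) w'(3,4) False w(3) by auto
    qed
  qed
  have "\<exists>t\<in>verts T. \<forall>A\<in>U ` B. V t \<inter> A \<noteq> {}"
  proof (rule bramble_cover[OF td])
    show "finite (U ` B)" using finite_B by simp
    show "U ` B \<noteq> {}" using card_B by auto
    show "A \<subseteq> verts G \<and> connected_graph (induced_subgraph G A)" if "A \<in> U ` B" for A
      using that con sub by blast
    show "A \<inter> A' \<noteq> {} \<or> (\<exists>x\<in>A. \<exists>y\<in>A'. {x, y} \<in> edges G)"
      if AA: "A \<in> U ` B" "A' \<in> U ` B" for A A'
    proof -
      obtain u v where "u \<in> B" "v \<in> B" "A = U u" "A' = U v" using AA by blast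
      then show ?thesis using touch[of u v] by simp
    qed
  qed
  then obtain t where t: "t \<in> verts T" "\<forall>A\<in>U ` B. V t \<inter> A \<noteq> {}" by blast
  then have "\<forall>v\<in>B. \<exists>x. x \<in> V t \<and> x \<in> U v" by blast
  then obtain g where g: "\<forall>v\<in>B. g v \<in> V t \<and> g v \<in> U v" by (rule bchoice[THEN exE])
  have "inj_on g B"
  proof (rule inj_onI)
    fix u v assume "u \<in> B" "v \<in> B" "g u = g v"
    moreover from this have "g u \<in> U u" "g u \<in> U v" using g by auto
    ultimately show "u = v" using disj by blast
  qed
  moreover have "finite (V t)"
    using td t(1) finite_verts by (auto simp: tree_decomposition_def intro: finite_subset)
  ultimately have "card B \<le> card (V t)" using g by (intro card_inj_on_le[of g]) auto
  moreover have "card (V t) - 1 \<le> width T V" using width_le_iff[OF td, of "width T V"] t(1) by simp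
  ultimately show ?thesis by linarith
qed

theorem tree_width_eq: "tree_width G = card B - 1"
  unfolding tree_width_def
proof (rule Least_equality)
  obtain T :: "nat sgraph" and V where "tree_decomposition G T V" "width T V \<le> card B - 1"
    using narrow_tree_decomposition by blast
  then show "\<exists>(T :: nat sgraph) V. tree_decomposition G T V \<and> width T V = card B - 1"
    using tree_decomposition_width_ge le_antisym by blast
next
  fix w assume "\<exists>(T :: nat sgraph) V. tree_decomposition G T V \<and> width T V = w"
  then show "card B - 1 \<le> w" using tree_decomposition_width_ge by blast
qed


section \<open>Connected tree-width\<close>


subsection \<open>Two overlapping stars\<close>

lemma card_star_le:
  assumes "finite D" and "h \<le> m"
  shows "card ({r} \<union> (\<Union>v\<in>D. q r v ` {0<..m}) \<union> q r z ` {0<..h}) \<le> Suc (card D * m + h)"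
proof -
  have "card (\<Union>v\<in>D. q r v ` {0<..m}) \<le> (\<Sum>v\<in>D. card (q r v ` {0<..m}))"
    by (rule card_UN_le[OF assms(1)])
  also have "\<dots> \<le> (\<Sum>v\<in>D. m)"
    by (intro sum_mono) (metis card_greaterThanAtMost card_image_le diff_zero finite_greaterThanAtMost)
  finally have "card (\<Union>v\<in>D. q r v ` {0<..m}) \<le> card D * m" by simp
  moreover have "card (q r z ` {0<..h}) \<le> h"
    by (metis card_greaterThanAtMost card_image_le diff_zero finite_greaterThanAtMost)
  moreover have "card ({r} \<union> (\<Union>v\<in>D. q r v ` {0<..m}) \<union> q r z ` {0<..h})
      \<le> card {r} + card (\<Union>v\<in>D. q r v ` {0<..m}) + card (q r z ` {0<..h})"
    by (meson add_le_mono1 card_Un_le order_trans)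
  ultimately show ?thesis by simp
qed

definition half_star :: "'a set \<Rightarrow> 'a \<Rightarrow> 'a \<Rightarrow> nat \<Rightarrow> 'a set" where
  "half_star D r z h = {q r v i |v i. v \<in> D \<and> i \<le> m \<or> v = z \<and> i \<le> h}"

lemma half_star_connected:
  assumes "D \<subseteq> B - {r}" "r \<in> B" "z \<in> B" "z \<noteq> r" "h \<le> m"
  shows "half_star D r z h \<subseteq> verts G"
    and "connected_graph (induced_subgraph G (half_star D r z h))"
proof -
  have mem: "q r v j \<in> half_star D r z h" if "v \<in> D \<and> j \<le> m \<or> v = z \<and> j \<le> h" for v j
    using that unfolding half_star_def by blast
  have rep: "\<exists>v i. v \<in> B \<and> v \<noteq> r \<and> i \<le> m \<and> x = q r v i \<and> (\<forall>j\<le>i. q r v j \<in> half_star D r z h)"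
    if x: "x \<in> half_star D r z h" for x
  proof -
    obtain v i where v: "x = q r v i" "v \<in> D \<and> i \<le> m \<or> v = z \<and> i \<le> h"
      using x unfolding half_star_def by blast
    have "q r v j \<in> half_star D r z h" if "j \<le> i" for j
      by (rule mem) (use v(2) that in auto)
    moreover have "v \<in> B" "v \<noteq> r" "i \<le> m" using v(2) assms by auto
    ultimately show ?thesis using v(1) by blast
  qed
  show sub: "half_star D r z h \<subseteq> verts G"
  proof
    fix x assume "x \<in> half_star D r z h"
    then obtain v i where "v \<in> B" "v \<noteq> r" "i \<le> m" "x = q r v i" using rep by blast
    then show "x \<in> verts G" using q_in_verts[of r v i] assms(2) by simp
  qed
  have "r \<in> half_star D r z h" using mem[of z 0] q_0[of r z] assms by simp
  then show "connected_graph (induced_subgraph G (half_star D r z h))"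
    using star_connected[OF assms(2) _ sub rep] by blast
qed

lemma card_half_star:
  assumes "D \<subseteq> B - {r}" "r \<in> B" "z \<in> B" "z \<noteq> r" "h \<le> m"
  shows "card (half_star D r z h) \<le> Suc (card D * m + h)"
proof -
  have fin: "finite D" using assms(1) finite_B by (meson finite_Diff finite_subset)
  have "half_star D r z h \<subseteq> {r} \<union> (\<Union>v\<in>D. q r v ` {0<..m}) \<union> q r z ` {0<..h}"
  proof
    fix x assume "x \<in> half_star D r z h"
    then obtain v i where v: "x = q r v i" "v \<in> D \<and> i \<le> m \<or> v = z \<and> i \<le> h"
      unfolding half_star_def by blast
    show "x \<in> {r} \<union> (\<Union>v\<in>D. q r v ` {0<..m}) \<union> q r z ` {0<..h}"
    proof (cases "i = 0")
      case True
      have "v \<in> B" "v \<noteq> r" using v(2) assms by auto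
      then show ?thesis using True v(1) q_0[of r v] assms(2) by simp
    next
      case False
      then have "v \<in> D \<and> i \<in> {0<..m} \<or> v = z \<and> i \<in> {0<..h}" using v(2) by simp
      then show ?thesis using v(1) by blast
    qed
  qed
  then have "card (half_star D r z h) \<le> card ({r} \<union> (\<Union>v\<in>D. q r v ` {0<..m}) \<union> q r z ` {0<..h})"
    using fin by (intro card_mono) auto
  also have "\<dots> \<le> Suc (card D * m + h)" by (rule card_star_le[OF fin assms(5)])
  finally show ?thesis .
qed

definition seg :: "'a \<Rightarrow> 'a \<Rightarrow> 'a set" where
  "seg u v = q u v ` {..m}"

lemma seg_sym:
  assumes "u \<in> B" "v \<in> B" "u \<noteq> v"
  shows "seg v u = seg u v"
  unfolding seg_def using q_segment[of u v] q_segment[of v u] inner_sym[of u v] assms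
  by (simp add: insert_commute)

lemma seg_connected:
  assumes uv: "u \<in> B" "v \<in> B" "u \<noteq> v"
  shows "seg u v \<subseteq> verts G" "connected_graph (induced_subgraph G (seg u v))"
    "card (seg u v) \<le> Suc m" "u \<in> seg u v"
proof -
  show sub: "seg u v \<subseteq> verts G" using q_in_verts[OF uv] by (auto simp: seg_def)
  show u: "u \<in> seg u v" using q_segment[OF uv] by (simp add: seg_def)
  show "connected_graph (induced_subgraph G (seg u v))"
  proof (rule star_connected[OF uv(1) u sub])
    fix x assume "x \<in> seg u v"
    then obtain i where "i \<le> m" "x = q u v i" by (auto simp: seg_def)
    moreover from this have "\<forall>j\<le>i. q u v j \<in> seg u v" by (auto simp: seg_def)
    ultimately show "\<exists>w i. w \<in> B \<and> w \<noteq> u \<and> i \<le> m \<and> x = q u w i \<and> (\<forall>j\<le>i. q u w j \<in> seg u v)"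
      using uv by blast
  qed
  show "card (seg u v) \<le> Suc m" unfolding seg_def using card_image_le[of "{..m}"] by simp
qed

text \<open>Let \<open>D\<close> consist of all branch vertices but \<open>r\<close> and \<open>z\<close>. The two stars that join \<open>r\<close> and \<open>z\<close>,
  respectively, to \<open>D\<close> are extended along the subdivided edge between \<open>r\<close> and \<open>z\<close> until they share a
  vertex in its middle. They form the two large parts; compared with a full star at \<open>r\<close>, the
  larger one saves \<open>m div 2\<close> vertices. The subdivided edges with both ends in \<open>D\<close> become small
  further parts.\<close>

lemma connected_decomposition:
  "\<exists>(T :: nat sgraph) V. connected_tree_decomposition G T V \<and>
     width T V \<le> (card B - 1) * m - m div 2"
proof -
  obtain r z where rz: "r \<in> B" "z \<in> B" "r \<noteq> z" using ex_triangle by blast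
  define D where "D = B - {r, z}"
  define h where "h = m - m div 2"
  have h: "h \<le> m" "m - h = m div 2" "m div 2 \<le> m" by (auto simp: h_def)
  have D: "D \<subseteq> B - {r}" "D \<subseteq> B - {z}" "finite D" using finite_B by (auto simp: D_def)
  have cD: "card D = card B - 2" using rz finite_B by (simp add: D_def card_Diff_subset)
  define C where "C = half_star D r z h"
  define C' where "C' = half_star D z r (m div 2)"
  define \<F> where "\<F> = insert C' {seg u v |u v. u \<in> D \<and> v \<in> D \<and> u \<noteq> v}"
  have B_cases: "w = r \<or> w = z \<or> w \<in> D" if "w \<in> B" for w using that by (auto simp: D_def)
  have D_C: "D \<subseteq> C"
  proof
    fix v assume v: "v \<in> D"
    then have "q r v m = v" using q_m[of r v] rz D by auto
    then show "v \<in> C" using v unfolding C_def half_star_def by force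
  qed
  have inner_D: "q u v i \<in> D" if "u \<in> D" "v \<in> D" "u \<noteq> v" "i = 0 \<or> i = m" for u v i
  proof -
    have "u \<in> B" "v \<in> B" using that D by auto
    then show ?thesis using that q_0[of u v] q_m[of u v] by auto
  qed
  have seg_seg: "seg u v \<inter> seg x y \<subseteq> C"
    if uv: "u \<in> D" "v \<in> D" "u \<noteq> v" and xy: "x \<in> D" "y \<in> D" "x \<noteq> y" and ne: "seg u v \<noteq> seg x y" for u v x y
  proof
    fix a assume "a \<in> seg u v \<inter> seg x y"
    then obtain i j where a: "i \<le> m" "j \<le> m" "a = q u v i" "a = q x y j" by (auto simp: seg_def)
    have B: "u \<in> B" "v \<in> B" "x \<in> B" "y \<in> B" using uv xy D by auto
    have "i = 0 \<or> i = m"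
    proof (rule ccontr)
      assume "\<not> ?thesis"
      then have "x = u \<and> y = v \<and> j = i \<or> x = v \<and> y = u \<and> j = m - i"
        by (intro q_inner) (use uv xy B a in auto)
      then show False using ne seg_sym[OF B(1,2) uv(3)] by auto
    qed
    then show "a \<in> C" using inner_D[OF uv] a(3) D_C by blast
  qed
  have seg_C': "seg u v \<inter> C' \<subseteq> C" if uv: "u \<in> D" "v \<in> D" "u \<noteq> v" for u v
  proof
    fix a assume "a \<in> seg u v \<inter> C'"
    then obtain i w j where a: "i \<le> m" "a = q u v i" "a = q z w j" "w \<in> D \<and> j \<le> m \<or> w = r \<and> j \<le> m div 2"
      by (auto simp: seg_def C'_def half_star_def)
    have B: "u \<in> B" "v \<in> B" "w \<in> B" "w \<noteq> z" "j \<le> m" using uv D a(4) rz h(3) by auto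
    have "i = 0 \<or> i = m"
    proof (rule ccontr)
      assume "\<not> ?thesis"
      then have "z = u \<and> w = v \<and> j = i \<or> z = v \<and> w = u \<and> j = m - i"
        by (intro q_inner) (use uv B a rz in auto)
      then show False using uv D by auto
    qed
    then show "a \<in> C" using inner_D[OF uv] a(2) D_C by blast
  qed
  have "finite {seg u v |u v. u \<in> D \<and> v \<in> D \<and> u \<noteq> v}"
    by (rule finite_subset[of _ "(\<lambda>(u, v). seg u v) ` (D \<times> D)"]) (use D(3) in auto)
  then have "finite \<F>" by (simp add: \<F>_def)
  moreover have "A \<inter> A' \<subseteq> C" if A: "A \<in> \<F>" "A' \<in> \<F>" "A \<noteq> A'" for A A'
  proof -
    consider "A = C'" "A' = C'"
      | u v where "A = C'" "A' = seg u v" "u \<in> D" "v \<in> D" "u \<noteq> v"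
      | u v where "A' = C'" "A = seg u v" "u \<in> D" "v \<in> D" "u \<noteq> v"
      | u v x y where "A = seg u v" "A' = seg x y" "u \<in> D" "v \<in> D" "u \<noteq> v" "x \<in> D" "y \<in> D" "x \<noteq> y"
      using A(1,2) unfolding \<F>_def by blast
    then show ?thesis
    proof cases
      case 2 then show ?thesis using seg_C' by blast
    next
      case 3 then show ?thesis using seg_C' by blast
    next
      case 4 then show ?thesis using seg_seg A(3) by metis
    qed (use A(3) in auto)
  qed
  ultimately have tree: "bag_tree (insert C \<F>)" by (rule bag_tree_star)
  have covered: "\<exists>A\<in>insert C \<F>. edge u v i \<subseteq> A"
    if uv: "u \<in> B" "v \<in> B" "u \<noteq> v" "i < m" for u v i
  proof -
    have C1: "\<exists>A\<in>insert C \<F>. edge x y j \<subseteq> A" if xy: "x = r" "y \<in> B" "y \<noteq> r" "j < m" for x y j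
    proof -
      consider "y \<in> D" | "y = z" "Suc j \<le> h" | "y = z" "h \<le> j" using B_cases[of y] xy by linarith
      then show ?thesis
      proof cases
        case 1
        then have "edge r y j \<subseteq> C"
          using that(4) unfolding C_def half_star_def edge_def by fastforce
        then show ?thesis using that by blast
      next
        case 2
        then have "edge r z j \<subseteq> C"
          unfolding C_def half_star_def edge_def by fastforce
        then show ?thesis using that 2 by blast
      next
        case 3
        have "edge r z j = edge z r (m - Suc j)" using edge_rev[of z r j] rz that by simp
        moreover have "Suc (m - Suc j) \<le> m div 2" using 3 that(4) h(2) by linarith
        then have "edge z r (m - Suc j) \<subseteq> C'"
          unfolding C'_def half_star_def edge_def by fastforce
        ultimately show ?thesis using that 3 by (auto simp: \<F>_def)
      qed
    qed
    have C2: "\<exists>A\<in>insert C \<F>. edge x y j \<subseteq> A" if "x = z" "y \<in> D" "j < m" for x y j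
    proof -
      have "edge z y j \<subseteq> C'"
        using that(2,3) unfolding C'_def half_star_def edge_def by fastforce
      then show ?thesis using that by (auto simp: \<F>_def)
    qed
    have rev: "edge u v i = edge v u (m - Suc i)" using edge_rev[of v u i] uv by simp
    have lt: "m - Suc i < m" using m_pos by simp
    consider "u = r" | "v = r" | "u = z" "v \<in> D" | "v = z" "u \<in> D" | "u \<in> D" "v \<in> D"
      using B_cases uv by blast
    then show ?thesis
    proof cases
      case 1 then show ?thesis using C1 uv by blast
    next
      case 2 then show ?thesis unfolding rev using C1 uv lt by blast
    next
      case 3 then show ?thesis using C2 uv by blast
    next
      case 4 then show ?thesis unfolding rev using C2 lt by blast
    next
      case 5
      have "edge u v i \<subseteq> seg u v" using uv(4) by (auto simp: edge_def seg_def)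
      moreover have "seg u v \<in> insert C \<F>" using 5 uv(3) unfolding \<F>_def by blast
      ultimately show ?thesis by blast
    qed
  qed
  have parts: "A \<subseteq> verts G \<and> connected_graph (induced_subgraph G A) \<and> card A - 1 \<le> (card B - 1) * m - m div 2"
    if A: "A \<in> insert C \<F>" for A
  proof -
    have "card B = Suc (Suc (Suc (card B - 3)))" using card_B by simp
    then obtain b where b: "card B = Suc (Suc (Suc b))" by blast
    have bound: "(card B - 1) * m - m div 2 = (card B - 2) * m + h"
      using h b by (simp add: h_def)
    consider "A = C" | "A = C'" | u v where "A = seg u v" "u \<in> D" "v \<in> D" "u \<noteq> v"
      using A unfolding \<F>_def by blast
    then show ?thesis
    proof cases
      case 1
      have "card C \<le> Suc (card D * m + h)"
        unfolding C_def by (rule card_half_star) (use D rz h in auto)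
      moreover have "C \<subseteq> verts G" "connected_graph (induced_subgraph G C)"
        unfolding C_def by (rule half_star_connected; use D rz h in auto)+
      ultimately show ?thesis unfolding 1 bound cD by simp
    next
      case 2
      have "card C' \<le> Suc (card D * m + m div 2)"
        unfolding C'_def by (rule card_half_star) (use D rz h in auto)
      moreover have "C' \<subseteq> verts G" "connected_graph (induced_subgraph G C')"
        unfolding C'_def by (rule half_star_connected; use D rz h in auto)+
      moreover have "m div 2 \<le> h" by (simp add: h_def)
      ultimately show ?thesis unfolding 2 bound cD by simp
    next
      case 3
      have B: "u \<in> B" "v \<in> B" using 3 D by auto
      have "m \<le> (card B - 1) * m - m div 2" unfolding bound b by simp
      then show ?thesis using seg_connected[OF B 3(4)] 3(1) by simp
    qed
  qed
  have "verts G = \<Union>(insert C \<F>)"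
  proof
    show "verts G \<subseteq> \<Union>(insert C \<F>)"
    proof
      fix x assume "x \<in> verts G"
      then obtain u v i where x: "u \<in> B" "v \<in> B" "u \<noteq> v" "i \<le> m" "x = q u v i"
        unfolding verts_G by blast
      have "x \<in> edge u v (if i < m then i else i - 1)"
        using x(4,5) m_pos by (auto simp: edge_def)
      moreover have "(if i < m then i else i - 1) < m" using x(4) m_pos by auto
      ultimately show "x \<in> \<Union>(insert C \<F>)" using covered[OF x(1-3)] by blast
    qed
    show "\<Union>(insert C \<F>) \<subseteq> verts G" using parts by blast
  qed
  moreover have "\<exists>A\<in>insert C \<F>. e \<subseteq> A" if "e \<in> edges G" for e
    using that covered unfolding edges_G' by blast
  ultimately obtain T :: "nat sgraph" and V
    where T: "tree_decomposition G T V" "V ` verts T = insert C \<F>"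
    using tree_decomposition_of_bag_tree[OF tree] by metis
  have "connected_graph (induced_subgraph G (V t))" if "t \<in> verts T" for t
  proof -
    have "V t \<in> insert C \<F>" using T(2) that by blast
    then show ?thesis using parts by blast
  qed
  then have "connected_tree_decomposition G T V"
    using T(1) by (simp add: connected_tree_decomposition_def)
  moreover have "width T V \<le> (card B - 1) * m - m div 2"
    unfolding width_le_iff[OF T(1)] T(2) using parts by blast
  ultimately show ?thesis by blast
qed


subsection \<open>How connected sets meet the subdivided edges\<close>

lemma inner_neighbour:
  assumes uv: "u \<in> B" "v \<in> B" "u \<noteq> v" and i: "0 < i" "i < m" and e: "{q u v i, b} \<in> edges G"
  obtains l where "i - 1 \<le> l" "l \<le> Suc i" "b = q u v l"
proof -
  obtain k where k: "i = Suc k" using i by (cases i) auto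
  have "{q u v i, b} \<in> {e \<in> edges G. q u v i \<in> e}" using e by simp
  also have "\<dots> = {edge u v k, edge u v (Suc k)}"
    unfolding k by (rule inner_incident[OF uv]) (use i(2) k in simp)
  finally have "{q u v i, b} \<in> {edge u v k, edge u v (Suc k)}" .
  then have "b \<in> edge u v k \<or> b \<in> edge u v (Suc k)" by blast
  then have "b = q u v k \<or> b = q u v (Suc k) \<or> b = q u v (Suc (Suc k))" by (auto simp: edge_def)
  then show ?thesis using that[of k] that[of "Suc k"] that[of "Suc (Suc k)"] k by auto
qed

text \<open>A connected set that contains neither end of a subdivided edge cannot leave its interior.\<close>

lemma connected_inner_cases:
  assumes X: "X \<subseteq> verts G" "connected_graph (induced_subgraph G X)"
    and uv: "u \<in> B" "v \<in> B" "u \<noteq> v" "u \<notin> X" "v \<notin> X"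
  shows "X \<subseteq> inner u v \<or> X \<inter> inner u v = {}"
proof (rule ccontr)
  assume "\<not> ?thesis"
  then obtain x y where xy: "x \<in> X" "x \<in> inner u v" "y \<in> X" "y \<notin> inner u v" by blast
  obtain a b where ab: "a \<in> inner u v" "b \<in> X" "b \<notin> inner u v" "{a, b} \<in> edges G"
    using connected_cut[OF X(2,1) xy] by (elim exE conjE)
  then obtain i where i: "0 < i" "i < m" "a = q u v i" by (auto simp: inner_def)
  obtain l where l: "i - 1 \<le> l" "l \<le> Suc i" "b = q u v l"
    by (rule inner_neighbour[OF uv(1-3) i(1,2)]) (use ab(4) i(3) in auto)
  have "l = 0 \<or> l = m" using l i ab(3) by (auto simp: inner_def)
  then have "b = u \<or> b = v" using l(3) q_0[OF uv(1-3)] q_m[OF uv(1-3)] by auto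
  then show False using ab(2) uv(4,5) by auto
qed

text \<open>Since \<open>u\<close> is missing, the vertices of \<open>X\<close> before a gap at \<open>j\<close> would be cut off from \<open>v\<close>.\<close>

lemma connected_final_segment:
  assumes X: "X \<subseteq> verts G" "connected_graph (induced_subgraph G X)"
    and uv: "u \<in> B" "v \<in> B" "u \<noteq> v" "u \<notin> X" "v \<in> X"
    and ij: "q u v i \<in> X" "i \<le> j" "j \<le> m"
  shows "q u v j \<in> X"
proof (rule ccontr)
  assume j: "q u v j \<notin> X"
  let ?A = "q u v ` {0<..<j}"
  have "i \<noteq> 0" using ij(1) uv(4) q_0[OF uv(1-3)] by metis
  moreover have "i \<noteq> j" using ij(1) j by metis
  ultimately have qA: "q u v i \<in> ?A" using ij by auto
  have vA: "v \<notin> ?A"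
  proof
    assume "v \<in> ?A"
    then obtain k where "0 < k" "k < m" "v = q u v k" using ij(3) by auto
    then show False using inner_notin_B[OF uv(1-3), of k] uv(2) by simp
  qed
  obtain a b where ab: "a \<in> ?A" "b \<in> X" "b \<notin> ?A" "{a, b} \<in> edges G"
    using connected_cut[OF X(2,1) ij(1) qA uv(5) vA] by (elim exE conjE)
  then obtain k where k: "0 < k" "k < j" "a = q u v k" by auto
  obtain l where l: "k - 1 \<le> l" "l \<le> Suc k" "b = q u v l"
    by (rule inner_neighbour[OF uv(1-3) k(1)]) (use ab(4) k ij(3) in auto)
  have "l = 0 \<or> l = j" using l k ab(3) by auto
  then show False using l(3) ab(2) j uv(4) q_0[OF uv(1-3)] by auto
qed


subsection \<open>Counting the vertices of a connected set\<close>

definition subclique :: "'a set \<Rightarrow> 'a set" where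
  "subclique S = S \<union> (\<Union>v\<in>S. \<Union>w\<in>S - {v}. inner v w)"

text \<open>Let \<open>A\<close> consist of the initial segments contained in \<open>X\<close> of subdivided edges starting in \<open>S\<close>. An
  edge of \<open>X\<close> that leaves \<open>A\<close> can only be the last edge of a subdivided edge, all of which is then
  contained in \<open>X\<close>.\<close>

lemma crossing_inner:
  assumes X: "X \<subseteq> verts G" "connected_graph (induced_subgraph G X)"
    and S: "S \<subseteq> X \<inter> B" "S \<noteq> {}" and w0: "w0 \<in> X \<inter> B - S"
  obtains v w where "v \<in> S" "w \<in> X \<inter> B - S" "inner v w \<subseteq> X"
proof -
  define A where "A = {q v w i |v w i. v \<in> S \<and> w \<in> B \<and> w \<noteq> v \<and> i < m \<and> (\<forall>j\<le>i. q v w j \<in> X)}"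
  have S_A: "v \<in> A" if v: "v \<in> S" for v
  proof -
    obtain w where w: "w \<in> B" "w \<noteq> v" using ex_other by blast
    have "q v w 0 = v" using q_0[of v w] v w S by auto
    moreover from this have "\<forall>j\<le>0. q v w j \<in> X" using v S by auto
    ultimately have "v = q v w 0 \<and> v \<in> S \<and> w \<in> B \<and> w \<noteq> v \<and> 0 < m \<and> (\<forall>j\<le>0. q v w j \<in> X)"
      using w v m_pos by simp
    then show ?thesis unfolding A_def by (intro CollectI exI)
  qed
  have A_B: "x \<in> S" if xA: "x \<in> A" "x \<in> B" for x
  proof -
    obtain v w i where x: "v \<in> S" "w \<in> B" "w \<noteq> v" "i < m" "x = q v w i"
      using xA(1) unfolding A_def by blast
    then have "v \<in> B" using S by auto
    then have "i = 0" using q_in_B_iff[of v w i] x that(2) by auto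
    then show ?thesis using x q_0[of v w] \<open>v \<in> B\<close> by auto
  qed
  obtain x where x: "x \<in> S" using S by auto
  have "w0 \<notin> A" "x \<in> X" "w0 \<in> X" using A_B w0 x S by blast+
  then obtain a b where ab: "a \<in> A" "b \<in> X" "b \<notin> A" "{a, b} \<in> edges G"
    using connected_cut[OF X(2,1), of x A w0] S_A[OF x] by blast
  obtain v w i where a: "v \<in> S" "w \<in> B" "w \<noteq> v" "i < m" "a = q v w i" "\<forall>j\<le>i. q v w j \<in> X"
    using ab(1) unfolding A_def by blast
  have v: "v \<in> B" using a(1) S by auto
  obtain w k where w: "w \<in> B" "w \<noteq> v" "k < m" "\<forall>j\<le>k. q v w j \<in> X" "b = q v w (Suc k)"
  proof (cases "i = 0")
    case True
    then have "a = v" using a q_0[of v w] v by auto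
    then have "{v, b} \<in> (\<lambda>w. edge v w 0) ` (B - {v})"
      using ab(4) branch_incident[OF v] by blast
    then obtain w' where w': "w' \<in> B" "w' \<noteq> v" "{v, b} = {v, q v w' (Suc 0)}"
      using q_0[OF v] by (auto simp: edge_def)
    have "b \<noteq> v" using ab(3) S_A[OF a(1)] by auto
    then have "b = q v w' (Suc 0)" using w'(3) by (auto simp: doubleton_eq_iff)
    moreover have "\<forall>j\<le>0. q v w' j \<in> X" using q_0[of v w'] w' v a(1) S by auto
    ultimately show ?thesis using that w' m_pos by blast
  next
    case False
    have vw: "v \<noteq> w" "0 < i" "{q v w i, b} \<in> edges G" using a(3,5) False ab(4) by auto
    obtain l where l: "i - 1 \<le> l" "l \<le> Suc i" "b = q v w l"
      by (rule inner_neighbour[OF v a(2) vw(1,2) a(4) vw(3)])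
    have "\<not> l \<le> i"
    proof
      assume "l \<le> i"
      then have "b \<in> A" using l(3) a unfolding A_def by fastforce
      then show False using ab(3) by simp
    qed
    then have "l = Suc i" using l(2) by simp
    then show ?thesis using that[OF a(2,3,4,6)] l(3) by simp
  qed
  have "Suc k = m"
  proof (rule ccontr)
    assume "Suc k \<noteq> m"
    then have "Suc k < m" using w(3) by simp
    moreover have "\<forall>j\<le>Suc k. q v w j \<in> X" using w(4,5) ab(2) by (auto simp: le_Suc_eq)
    ultimately have "b \<in> A" using w a(1) unfolding A_def by blast
    then show False using ab(3) by simp
  qed
  then have "b = w" using w q_m[of v w] v by auto
  then have "w \<in> X \<inter> B - S" using ab(2,3) w(1) S_A by blast
  moreover have "inner v w \<subseteq> X" using w(4) \<open>Suc k = m\<close> by (auto simp: inner_def)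
  ultimately show ?thesis using that a(1) by blast
qed

lemma card_inner:
  assumes "u \<in> B" "v \<in> B" "u \<noteq> v"
  shows "card (inner u v) = m - 1" "finite (inner u v)"
proof -
  have "inj_on (q u v) {0<..<m}" using q_inj[OF assms] by (intro inj_onI) auto
  then show "card (inner u v) = m - 1" by (simp add: inner_def card_image)
qed (simp add: inner_def)

lemma subclique_inner_disjoint:
  assumes "S \<subseteq> B" "v \<in> B" "w \<in> B" "v \<noteq> w" "v \<notin> S \<or> w \<notin> S"
  shows "inner v w \<inter> subclique S = {}"
proof -
  have "inner v w \<inter> inner x y = {}" if "x \<in> S" "y \<in> S - {x}" for x y
    using that assms by (intro inner_disjoint) auto
  then show ?thesis using inner_not_B[OF assms(2-4)] assms(1) unfolding subclique_def by blast
qed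

text \<open>A spanning tree of the branch vertices in \<open>X\<close> is grown one subdivided edge at a time; each step
  contributes a new branch vertex and the \<open>m - 1\<close> inner vertices on the way to it.\<close>

lemma connected_subclique_card:
  assumes X: "X \<subseteq> verts G" "connected_graph (induced_subgraph G X)"
  shows "j < card (X \<inter> B) \<Longrightarrow>
    \<exists>S \<subseteq> X \<inter> B. card S = Suc j \<and> Suc (j * m) \<le> card (X \<inter> subclique S)"
proof (induction j)
  case 0
  then obtain v where v: "v \<in> X \<inter> B" by (metis card_gt_0_iff ex_in_conv)
  then have "X \<inter> subclique {v} = {v}" by (auto simp: subclique_def)
  then show ?case using v by (intro exI[of _ "{v}"]) simp
next
  case (Suc j)
  then obtain S where S: "S \<subseteq> X \<inter> B" "card S = Suc j" "Suc (j * m) \<le> card (X \<inter> subclique S)"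
    using Suc_lessD by blast
  have finX: "finite X" using X(1) finite_verts finite_subset by blast
  have "S \<noteq> X \<inter> B" using S(2) Suc.prems by auto
  then obtain w0 where "w0 \<in> X \<inter> B - S" using S(1) by blast
  moreover have "S \<noteq> {}" using S(2) by auto
  ultimately obtain v w where vw: "v \<in> S" "w \<in> X \<inter> B - S" "inner v w \<subseteq> X"
    using crossing_inner[OF X S(1)] by blast
  have vw': "v \<in> B" "w \<in> B" "v \<noteq> w" using vw S(1) by auto
  let ?N = "insert w (inner v w)"
  have "w \<notin> inner v w" using inner_not_B[OF vw'] vw'(2) by blast
  then have card_N: "card ?N = m" using card_inner[OF vw'] m_pos by simp
  have "w \<notin> inner x y" if "x \<in> S" "y \<in> S - {x}" for x y
    using inner_not_B[of x y] that S(1) vw'(2) by blast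
  then have "w \<notin> subclique S" using vw(2) by (auto simp: subclique_def)
  moreover have "inner v w \<inter> subclique S = {}"
    by (rule subclique_inner_disjoint) (use S(1) vw vw' in auto)
  ultimately have disj: "(X \<inter> subclique S) \<inter> ?N = {}" by blast
  have "(X \<inter> subclique S) \<union> ?N \<subseteq> X \<inter> subclique (insert w S)"
  proof -
    have "subclique S \<subseteq> subclique (insert w S)" by (auto simp: subclique_def)
    moreover have "?N \<subseteq> subclique (insert w S)" using vw vw'(3) by (auto simp: subclique_def)
    ultimately show ?thesis using vw(2,3) by blast
  qed
  then have "card ((X \<inter> subclique S) \<union> ?N) \<le> card (X \<inter> subclique (insert w S))"
    using finX by (intro card_mono) auto
  moreover have "card ((X \<inter> subclique S) \<union> ?N) = card (X \<inter> subclique S) + m"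
    using disj finX card_inner(2)[OF vw'] card_N by (subst card_Un_disjoint) auto
  ultimately have "Suc (Suc j * m) \<le> card (X \<inter> subclique (insert w S))" using S(3) by simp
  moreover have "finite S" using S(1) finite_B by (meson finite_Int finite_subset)
  then have "card (insert w S) = Suc (Suc j)" using S(2) vw(2) by simp
  moreover have "insert w S \<subseteq> X \<inter> B" using S(1) vw(2) by blast
  ultimately show ?case by blast
qed

text \<open>Besides a spanning tree of its branch vertices, \<open>X\<close> contains the parts of those subdivided edges
  that leave the set of these branch vertices.\<close>

lemma connected_card_ge:
  assumes X: "X \<subseteq> verts G" "connected_graph (induced_subgraph G X)" "X \<inter> B \<noteq> {}"
    and P: "P \<subseteq> B - X" and Q: "Q \<subseteq> X \<inter> B"
  shows "(card (X \<inter> B) - 1) * m + 1 + (\<Sum>(u, v)\<in>P \<times> Q. card (X \<inter> inner u v)) \<le> card X"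
proof -
  have fin: "finite X" "finite (X \<inter> B)" "finite P" "finite Q"
    using X(1) P Q finite_verts finite_B by (meson finite_Diff finite_Int finite_subset)+
  define R where "R = X \<inter> B"
  have "card R > 0" using X(3) fin by (simp add: R_def card_gt_0_iff)
  then obtain S where S: "S \<subseteq> R" "card S = card R" "Suc ((card R - 1) * m) \<le> card (X \<inter> subclique S)"
    using connected_subclique_card[OF X(1,2), of "card R - 1"] by (auto simp: R_def)
  then have "S = R" using fin(2) by (metis R_def card_subset_eq)
  then have tree: "(card R - 1) * m + 1 \<le> card (X \<inter> subclique R)" using S(3) by simp
  have PQ: "u \<in> B" "v \<in> B" "u \<noteq> v" "u \<notin> R" if "(u, v) \<in> P \<times> Q" for u v
    using that P Q by (auto simp: R_def)
  let ?I = "\<lambda>(u, v). X \<inter> inner u v"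
  have disj: "?I d \<inter> ?I d' = {}" if d: "d \<in> P \<times> Q" "d' \<in> P \<times> Q" "d \<noteq> d'" for d d'
  proof -
    obtain u v x y where uv: "d = (u, v)" "d' = (x, y)" by (cases d, cases d')
    have "\<not> (x = v \<and> y = u)" using d uv P Q by auto
    then have "inner u v \<inter> inner x y = {}"
      using inner_disjoint[of u v x y] PQ[of u v] PQ[of x y] d uv by auto
    then show ?thesis using uv by auto
  qed
  have "card (\<Union>d\<in>P \<times> Q. ?I d) = (\<Sum>d\<in>P \<times> Q. card (?I d))"
    using fin disj by (intro card_UN_disjoint) auto
  also have "\<dots> = (\<Sum>(u, v)\<in>P \<times> Q. card (X \<inter> inner u v))"
    by (intro sum.cong) auto
  finally have ext: "card (\<Union>d\<in>P \<times> Q. ?I d) = (\<Sum>(u, v)\<in>P \<times> Q. card (X \<inter> inner u v))" .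
  have "inner u v \<inter> subclique R = {}" if "(u, v) \<in> P \<times> Q" for u v
    by (rule subclique_inner_disjoint) (use PQ[OF that] in \<open>auto simp: R_def\<close>)
  then have "(X \<inter> subclique R) \<inter> (\<Union>d\<in>P \<times> Q. ?I d) = {}" by blast
  then have "card ((X \<inter> subclique R) \<union> (\<Union>d\<in>P \<times> Q. ?I d)) = card (X \<inter> subclique R) + card (\<Union>d\<in>P \<times> Q. ?I d)"
    using fin by (intro card_Un_disjoint) auto
  moreover have "card ((X \<inter> subclique R) \<union> (\<Union>d\<in>P \<times> Q. ?I d)) \<le> card X"
    using fin by (intro card_mono) auto
  ultimately show ?thesis using tree ext by (simp add: R_def)
qed


subsection \<open>The bramble\<close>

text \<open>What can be reached from the branch vertices outside \<open>X\<close> within single subdivided edges while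
  avoiding \<open>X\<close>. If \<open>X\<close> is connected and contains a branch vertex, then it leaves the subdivided
  edges between the branch vertices outside \<open>X\<close> intact, so that this set is connected. The free
  parts of the small connected sets are the bramble for the lower bound.\<close>

definition free_part :: "'a set \<Rightarrow> 'a set" where
  "free_part X = {q u v i |u v i. u \<in> B \<and> v \<in> B \<and> u \<noteq> v \<and> i \<le> m \<and> (\<forall>j\<le>i. q u v j \<notin> X)}"

lemma free_partI:
  "\<lbrakk>u \<in> B; v \<in> B; u \<noteq> v; i \<le> m; \<And>j. j \<le> i \<Longrightarrow> q u v j \<notin> X\<rbrakk> \<Longrightarrow> q u v i \<in> free_part X"
  unfolding free_part_def by blast

lemma free_part_disjoint: "free_part X \<inter> X = {}"
  unfolding free_part_def by blast

lemma free_part_subset: "free_part X \<subseteq> verts G"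
  using q_in_verts unfolding free_part_def by blast

lemma branch_in_free_part:
  assumes "u \<in> B" "u \<notin> X" shows "u \<in> free_part X"
proof -
  obtain w where w: "w \<in> B" "w \<noteq> u" using ex_other by blast
  then have "q u w 0 = u" using q_0 assms by auto
  then show ?thesis using free_partI[of u w 0 X] assms w by auto
qed

lemma free_part_connected:
  assumes X: "X \<subseteq> verts G" "connected_graph (induced_subgraph G X)" "X \<inter> B \<noteq> {}"
    and u: "u \<in> B" "u \<notin> X"
  shows "connected_graph (induced_subgraph G (free_part X))"
proof (rule connected_via_root[OF branch_in_free_part[OF u] free_part_subset])
  fix x assume "x \<in> free_part X"
  then obtain w v i where x: "w \<in> B" "v \<in> B" "w \<noteq> v" "i \<le> m" "\<forall>j\<le>i. q w v j \<notin> X" "x = q w v i"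
    unfolding free_part_def by blast
  have w: "w \<notin> X" using x q_0[of w v] by auto
  have "(q w v 0, q w v i) \<in> (adj_in G (free_part X))\<^sup>*"
    using x by (intro segment_reach free_partI) auto
  then have wx: "(w, x) \<in> (adj_in G (free_part X))\<^sup>*" using x q_0[of w v] by simp
  have "(u, w) \<in> (adj_in G (free_part X))\<^sup>*"
  proof (cases "u = w")
    case False
    have "\<not> X \<subseteq> inner u w" using inner_not_B[OF u(1) x(1) False] X(3) by blast
    then have "X \<inter> inner u w = {}"
      using connected_inner_cases[OF X(1,2) u(1) x(1) False u(2) w] by blast
    then have "X \<inter> q u w ` {..m} = {}" using q_segment[OF u(1) x(1) False] u(2) w by simp
    then have "q u w l \<in> free_part X" if "l \<le> m" for l
      using that u x False by (intro free_partI) auto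
    then have "(q u w 0, q u w m) \<in> (adj_in G (free_part X))\<^sup>*"
      using u(1) x(1) False by (intro segment_reach) auto
    then show ?thesis using q_0[OF u(1) x(1) False] q_m[OF u(1) x(1) False] by simp
  qed simp
  then show "(u, x) \<in> (adj_in G (free_part X))\<^sup>*" using wx by (rule rtrancl_trans)
qed

definition touching :: "'a set \<Rightarrow> 'a set \<Rightarrow> bool" where
  "touching U W \<longleftrightarrow> U \<inter> W \<noteq> {} \<or> (\<exists>x\<in>U. \<exists>y\<in>W. {x, y} \<in> edges G)"

text \<open>On the subdivided edge from \<open>u\<close> to \<open>v\<close>, the set \<open>X\<close> occupies a final segment and \<open>Y\<close> an initial
  one. Unless the two segments overlap, the free parts of \<open>X\<close> and \<open>Y\<close>, which come from \<open>u\<close> and \<open>v\<close>,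
  meet or are joined by an edge in between.\<close>

lemma blocked_edge_card:
  assumes X: "X \<subseteq> verts G" "connected_graph (induced_subgraph G X)"
    and Y: "Y \<subseteq> verts G" "connected_graph (induced_subgraph G Y)"
    and uv: "u \<in> B" "v \<in> B" "u \<noteq> v"
    and u: "u \<notin> X" "u \<in> Y" and v: "v \<in> X" "v \<notin> Y"
    and nt: "\<not> touching (free_part X) (free_part Y)"
  shows "m \<le> card (X \<inter> inner u v) + card (Y \<inter> inner u v)"
proof -
  have vu: "v \<in> B" "u \<in> B" "v \<noteq> u" using uv by auto
  define a where "a = (LEAST i. q u v i \<in> X)"
  have "q u v m \<in> X" using v q_m[OF uv] by simp
  then have a: "q u v a \<in> X" "a \<le> m" unfolding a_def by (rule LeastI, rule Least_le)
  have below: "q u v j \<notin> X" if "j < a" for j using that not_less_Least unfolding a_def by blast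
  have "a \<noteq> 0" using a(1) u(1) q_0[OF uv] by (metis)
  then obtain b where b: "a = Suc b" by (cases a) auto
  have free_X: "q u v b \<in> free_part X" using a b below uv by (intro free_partI) auto
  have Y_down: "q u v j \<in> Y" if "q u v i \<in> Y" "j \<le> i" "i \<le> m" for i j
  proof -
    have "q v u (m - i) \<in> Y" using that q_rev[OF uv, of "m - i"] by simp
    then have "q v u (m - j) \<in> Y"
      using connected_final_segment[OF Y vu v(2) u(2)] that by simp
    then show ?thesis using that q_rev[OF uv, of "m - j"] by simp
  qed
  have aY: "q u v a \<in> Y"
  proof (rule ccontr)
    assume "q u v a \<notin> Y"
    then have notY: "q u v j \<notin> Y" if "a \<le> j" "j \<le> m" for j using Y_down that by blast
    have "q v u (m - a) \<in> free_part Y"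
    proof (rule free_partI[OF vu])
      fix j assume j: "j \<le> m - a"
      then have "q v u j = q u v (m - j)" by (intro q_rev[OF uv]) simp
      then show "q v u j \<notin> Y" using notY[of "m - j"] j a(2) by simp
    qed simp
    moreover have "q v u (m - a) = q u v a" using q_rev[OF uv, of "m - a"] a(2) by simp
    moreover have "{q u v b, q u v a} \<in> edges G"
      using edge_in[OF uv, of b] a(2) b by (simp add: edge_def)
    ultimately show False using nt free_X unfolding touching_def by auto
  qed
  then have "a \<noteq> m" using v(2) q_m[OF uv] by metis
  then have am: "a < m" using a(2) by simp
  have inj: "inj_on (q u v) I" if "I \<subseteq> {..m}" for I
    using q_inj[OF uv] that by (intro inj_onI) blast
  have "q u v ` {a..<m} \<subseteq> X \<inter> inner u v"
    using connected_final_segment[OF X uv u(1) v(1) a(1)] b by (auto simp: inner_def)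
  moreover have "finite (X \<inter> inner u v)" using card_inner(2)[OF uv] by simp
  ultimately have "card (q u v ` {a..<m}) \<le> card (X \<inter> inner u v)" by (intro card_mono)
  then have "m - a \<le> card (X \<inter> inner u v)" using inj[of "{a..<m}"] by (simp add: card_image subset_eq)
  moreover have "q u v ` {0<..a} \<subseteq> Y \<inter> inner u v"
    using Y_down[OF aY] am by (auto simp: inner_def)
  then have "card (q u v ` {0<..a}) \<le> card (Y \<inter> inner u v)"
    using card_inner(2)[OF uv] by (intro card_mono) auto
  then have "a \<le> card (Y \<inter> inner u v)"
    using inj[of "{0<..a}"] am by (simp add: card_image subset_eq)
  ultimately show ?thesis by simp
qed

lemma small_connected_misses_branch:
  assumes X: "X \<subseteq> verts G" "connected_graph (induced_subgraph G X)"
    and card_X: "card X \<le> (card B - 1) * m - m div 2"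
  shows "\<exists>u\<in>B. u \<notin> X"
proof (rule ccontr)
  assume "\<not> ?thesis"
  then have XB: "X \<inter> B = B" by blast
  moreover have "B \<noteq> {}" using card_B by auto
  ultimately have "(card B - 1) * m + 1 \<le> card X"
    using connected_card_ge[OF X, of "{}" "{}"] by simp
  then show False using card_X by simp
qed

text \<open>Otherwise no branch vertex avoids both \<open>X\<close> and \<open>Y\<close>. Let \<open>p\<close> and \<open>q\<close> be the numbers of branch
  vertices outside \<open>X\<close> and outside \<open>Y\<close>, and \<open>n = card B\<close>. The spanning trees in \<open>X\<close> and \<open>Y\<close> together
  with the \<open>p * q\<close> blocked subdivided edges between these two sets of branch vertices give
  \<open>card X + card Y \<ge> (2 * n - p - q - 2) * m + 2 + p * q * m \<ge> (2 * n - 3) * m + 2\<close>,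
  using \<open>(p - 1) * (q - 1) \<ge> 0\<close>. But twice the permitted size is at most \<open>(2 * n - 3) * m + 1\<close>.\<close>

lemma free_parts_touch:
  assumes X: "X \<subseteq> verts G" "connected_graph (induced_subgraph G X)" "X \<inter> B \<noteq> {}"
    and Y: "Y \<subseteq> verts G" "connected_graph (induced_subgraph G Y)" "Y \<inter> B \<noteq> {}"
    and card_X: "card X \<le> (card B - 1) * m - m div 2"
    and card_Y: "card Y \<le> (card B - 1) * m - m div 2"
  shows "touching (free_part X) (free_part Y)"
proof (rule ccontr)
  assume nt: "\<not> ?thesis"
  define P where "P = B - X"
  define Q where "Q = B - Y"
  have "w \<in> X \<or> w \<in> Y" if "w \<in> B" for w
    using nt branch_in_free_part[of w] that unfolding touching_def by blast
  then have PY: "P \<subseteq> Y \<inter> B" and QX: "Q \<subseteq> X \<inter> B" by (auto simp: P_def Q_def)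
  have fin: "finite P" "finite Q" "finite (X \<inter> B)" "finite (Y \<inter> B)"
    using finite_B by (auto simp: P_def Q_def)
  have "P \<noteq> {}" "Q \<noteq> {}"
    using small_connected_misses_branch[OF X(1,2) card_X]
      small_connected_misses_branch[OF Y(1,2) card_Y] by (auto simp: P_def Q_def)
  then obtain p' q' where pq: "card P = Suc p'" "card Q = Suc q'"
    using fin by (metis card_gt_0_iff gr0_implies_Suc)
  obtain x y where xy: "card (X \<inter> B) = Suc x" "card (Y \<inter> B) = Suc y"
    using fin X(3) Y(3) by (metis card_gt_0_iff gr0_implies_Suc)
  have "card B = card (X \<inter> B) + card P"
    using fin by (subst card_Un_disjoint[symmetric]) (auto simp: P_def Int_commute intro: arg_cong[of _ _ card])
  then have n1: "card B = x + p' + 2" using pq xy by simp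
  have "card B = card (Y \<inter> B) + card Q"
    using fin by (subst card_Un_disjoint[symmetric]) (auto simp: Q_def Int_commute intro: arg_cong[of _ _ card])
  then have n2: "card B = y + q' + 2" using pq xy by simp
  define SX where "SX = (\<Sum>(u, v)\<in>P \<times> Q. card (X \<inter> inner u v))"
  define SY where "SY = (\<Sum>(u, v)\<in>P \<times> Q. card (Y \<inter> inner u v))"
  have SX: "x * m + 1 + SX \<le> card X"
    using connected_card_ge[OF X, of P Q] QX xy by (simp add: P_def SX_def)
  have "(\<Sum>(v, u)\<in>Q \<times> P. card (Y \<inter> inner v u)) = (\<Sum>(u, v)\<in>P \<times> Q. card (Y \<inter> inner v u))"
    unfolding sum.cartesian_product[symmetric] by (rule sum.swap)
  also have "\<dots> = SY"
    unfolding SY_def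
  proof (rule sum.cong[OF refl], clarify)
    fix u v assume "u \<in> P" "v \<in> Q"
    then have "u \<in> B" "v \<in> B" "u \<noteq> v" using PY QX by (auto simp: P_def Q_def)
    then show "card (Y \<inter> inner v u) = card (Y \<inter> inner u v)" using inner_sym by simp
  qed
  finally have SY: "y * m + 1 + SY \<le> card Y"
    using connected_card_ge[OF Y, of Q P] PY xy by (simp add: Q_def)
  have "(\<Sum>d\<in>P \<times> Q. m) \<le> (\<Sum>(u, v)\<in>P \<times> Q. card (X \<inter> inner u v) + card (Y \<inter> inner u v))"
  proof (rule sum_mono, clarify)
    fix u v assume uv: "u \<in> P" "v \<in> Q"
    show "m \<le> card (X \<inter> inner u v) + card (Y \<inter> inner u v)"
      by (rule blocked_edge_card[OF X(1,2) Y(1,2)]) (use uv PY QX nt in \<open>auto simp: P_def Q_def\<close>)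
  qed
  also have "\<dots> = SX + SY" unfolding SX_def SY_def by (simp add: case_prod_unfold sum.distrib)
  finally have S: "Suc p' * Suc q' * m \<le> SX + SY"
    using pq by (simp add: card_cartesian_product)
  \<comment> \<open>With \<open>p = p' + 1\<close> and \<open>q = q' + 1\<close>, the term \<open>p' * q' * m\<close> that remains below is the slack
    \<open>(p - 1) * (q - 1) * m\<close>.\<close>
  have "2 * (card B - 1) = x + y + p' + q' + 2" using n1 n2 by linarith
  then have "2 * ((card B - 1) * m) = (x + y + p' + q' + 2) * m" by (metis mult.assoc)
  moreover have "card X + card Y + 2 * (m div 2) \<le> 2 * ((card B - 1) * m)"
    using card_X card_Y SX SY by linarith
  ultimately have "x * m + y * m + 2 + Suc p' * Suc q' * m + 2 * (m div 2) \<le> (x + y + p' + q' + 2) * m"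
    using SX SY S by linarith
  then have "2 + p' * q' * m + 2 * (m div 2) \<le> m" by (simp add: algebra_simps)
  then have "2 + 2 * (m div 2) \<le> m" by linarith
  then show False by linarith
qed

text \<open>A part of the decomposition that meets all free parts cannot be contained in a set \<open>X\<close> of the
  family \<open>\<X>\<close>, as the free part of \<open>X\<close> avoids \<open>X\<close>. A small connected part with a branch vertex is
  itself in \<open>\<X>\<close>, and one without lies inside a single subdivided edge, which is in \<open>\<X>\<close>.\<close>

lemma connected_width_ge:
  assumes ctd: "connected_tree_decomposition G T V"
  shows "(card B - 1) * m - m div 2 \<le> width T V"
proof (rule ccontr)
  let ?s = "(card B - 1) * m - m div 2"
  assume "\<not> ?thesis"
  then have w: "width T V \<le> ?s - 1" by simp
  have td: "tree_decomposition G T V" using ctd by (simp add: connected_tree_decomposition_def)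
  \<comment> \<open>A whole subdivided edge, with both ends, is still small. This uses that there are at least
    three branch vertices.\<close>
  have "2 * m \<le> (card B - 1) * m" using card_B by (intro mult_le_mono1) simp
  moreover have "m div 2 < m" using m_pos by simp
  ultimately have s: "Suc m \<le> ?s" by linarith
  have V: "V t \<subseteq> verts G" "connected_graph (induced_subgraph G (V t))" "card (V t) \<le> ?s"
    if t: "t \<in> verts T" for t
  proof -
    show "V t \<subseteq> verts G" using td t by (auto simp: tree_decomposition_def)
    show "connected_graph (induced_subgraph G (V t))"
      using ctd t by (simp add: connected_tree_decomposition_def)
    have "card (V t) - 1 \<le> ?s - 1" using w t unfolding width_le_iff[OF td] by blast
    then show "card (V t) \<le> ?s" using s by linarith
  qed
  define \<X> where "\<X> = {X. X \<subseteq> verts G \<and> connected_graph (induced_subgraph G X) \<and> X \<inter> B \<noteq> {} \<and> card X \<le> ?s}"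
  have seg: "seg u v \<in> \<X>" if "u \<in> B" "v \<in> B" "u \<noteq> v" for u v
    using seg_connected[OF that] s that(1) unfolding \<X>_def by auto
  have "\<exists>t\<in>verts T. \<forall>U\<in>free_part ` \<X>. V t \<inter> U \<noteq> {}"
  proof (rule bramble_cover[OF td])
    have "\<X> \<subseteq> Pow (verts G)" by (auto simp: \<X>_def)
    then show "finite (free_part ` \<X>)" using finite_verts by (meson finite_Pow_iff finite_imageI finite_subset)
    show "free_part ` \<X> \<noteq> {}" using seg ex_triangle by blast
    fix U assume "U \<in> free_part ` \<X>"
    then obtain X where X: "U = free_part X" "X \<subseteq> verts G" "connected_graph (induced_subgraph G X)"
      "X \<inter> B \<noteq> {}" "card X \<le> ?s" by (auto simp: \<X>_def)
    obtain u where u: "u \<in> B" "u \<notin> X" using small_connected_misses_branch[OF X(2,3,5)] by blast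
    show "U \<subseteq> verts G \<and> connected_graph (induced_subgraph G U)"
      unfolding X(1) using free_part_subset free_part_connected[OF X(2-4) u] by blast
    fix W assume "W \<in> free_part ` \<X>"
    then obtain Y where Y: "W = free_part Y" "Y \<subseteq> verts G" "connected_graph (induced_subgraph G Y)"
      "Y \<inter> B \<noteq> {}" "card Y \<le> ?s" by (auto simp: \<X>_def)
    show "U \<inter> W \<noteq> {} \<or> (\<exists>x\<in>U. \<exists>y\<in>W. {x, y} \<in> edges G)"
      using free_parts_touch[OF X(2-4) Y(2-4) X(5) Y(5)] unfolding X(1) Y(1) touching_def .
  qed
  then obtain t where t: "t \<in> verts T" "\<forall>U\<in>free_part ` \<X>. V t \<inter> U \<noteq> {}" by (rule bexE)
  have "\<exists>X\<in>\<X>. V t \<subseteq> X"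
  proof (cases "V t \<inter> B = {}")
    case False
    then have "V t \<in> \<X>" using V[OF t(1)] by (simp add: \<X>_def)
    then show ?thesis by blast
  next
    case True
    obtain x where x: "x \<in> V t"
      using V(2)[OF t(1)] unfolding connected_induced_iff[OF V(1)[OF t(1)]] by blast
    then have "x \<in> verts G" using V(1)[OF t(1)] by blast
    then obtain u v i where uv: "u \<in> B" "v \<in> B" "u \<noteq> v" "i \<le> m" "x = q u v i"
      unfolding verts_G by blast
    have "u \<notin> V t" "v \<notin> V t" using True uv(1,2) by auto
    moreover have "i \<noteq> 0" "i \<noteq> m" using q_in_B_iff[OF uv(1-4)] uv(5) x True by auto
    then have "x \<in> inner u v" using uv(4,5) by (auto simp: inner_def)
    ultimately have "V t \<subseteq> inner u v"
      using connected_inner_cases[OF V(1,2)[OF t(1)] uv(1-3)] x by blast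
    also have "\<dots> \<subseteq> seg u v" unfolding seg_def q_segment[OF uv(1-3)] by blast
    finally show ?thesis using seg[OF uv(1-3)] by blast
  qed
  then obtain X where "X \<in> \<X>" "V t \<subseteq> X" by blast
  moreover from this have "V t \<inter> free_part X \<noteq> {}" using t(2) by simp
  ultimately show False using free_part_disjoint[of X] by blast
qed

theorem connected_tree_width_eq: "connected_tree_width G = (card B - 1) * m - m div 2"
  unfolding connected_tree_width_def
proof (rule Least_equality)
  obtain T :: "nat sgraph" and V where "connected_tree_decomposition G T V"
    "width T V \<le> (card B - 1) * m - m div 2"
    using connected_decomposition by blast
  then show "\<exists>(T :: nat sgraph) V. connected_tree_decomposition G T V \<and>
      width T V = (card B - 1) * m - m div 2"
    using connected_width_ge le_antisym by blast
next
  fix w assume "\<exists>(T :: nat sgraph) V. connected_tree_decomposition G T V \<and> width T V = w"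
  then show "(card B - 1) * m - m div 2 \<le> w" using connected_width_ge by blast
qed

end


section \<open>Subdivisions of complete graphs\<close>

lemma inner_verts_nth:
  assumes "length p = k + 2"
  shows "inner_verts p = (!) p ` {0<..<Suc k}"
proof -
  have len: "length (butlast (tl p)) = k" using assms by simp
  have "butlast (tl p) ! i = p ! Suc i" if "i < k" for i
    using that assms by (simp add: nth_butlast nth_tl)
  then have "(!) (butlast (tl p)) ` {..<k} = (\<lambda>i. p ! Suc i) ` {..<k}"
    by (intro image_cong) auto
  moreover have "set (butlast (tl p)) = (!) (butlast (tl p)) ` {..<k}"
    unfolding len[symmetric] by (auto simp: set_conv_nth)
  ultimately have "set (butlast (tl p)) = (\<lambda>i. p ! Suc i) ` {..<k}" by simp
  also have "\<dots> = (!) p ` Suc ` {..<k}" by (simp add: image_image)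
  also have "Suc ` {..<k} = {0<..<Suc k}"
    unfolding image_Suc_lessThan by auto
  finally show ?thesis by (simp add: inner_verts_def)
qed

text \<open>The given path for an edge \<open>{u, v}\<close> runs in only one direction, and \<open>q u v\<close> reverses it if it
  starts at \<open>v\<close>.\<close>

lemma subdivided_clique_exists:
  fixes K G :: "'a sgraph"
  assumes K: "complete_graph K" and card: "3 \<le> card (verts K)" and sub: "subdivision_by k K G"
  shows "\<exists>q. subdivided_clique G (verts K) (Suc k) q"
proof -
  define B where "B = verts K"
  define m where "m = Suc k"
  obtain P where P': "(\<forall>e\<in>edges K. length (P e) = k + 2 \<and> distinct (P e) \<and> {hd (P e), last (P e)} = e \<and>
        inner_verts (P e) \<inter> verts K = {}) \<and>
     (\<forall>e\<in>edges K. \<forall>f\<in>edges K. e \<noteq> f \<longrightarrow> inner_verts (P e) \<inter> inner_verts (P f) = {}) \<and>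
     verts G = verts K \<union> (\<Union>e\<in>edges K. inner_verts (P e)) \<and>
     edges G = (\<Union>e\<in>edges K. path_edges (P e))"
    using sub unfolding subdivision_by_def by (rule exE)
  have P: "length (P e) = k + 2 \<and> distinct (P e) \<and> {hd (P e), last (P e)} = e \<and>
      inner_verts (P e) \<inter> verts K = {}" if "e \<in> edges K" for e
    by (rule bspec[OF conjunct1[OF P'] that])
  have disj: "inner_verts (P e) \<inter> inner_verts (P f) = {}"
    if "e \<in> edges K" "f \<in> edges K" "e \<noteq> f" for e f
    using bspec[OF bspec[OF conjunct1[OF conjunct2[OF P']] that(1)] that(2)] that(3) by (rule mp)
  have vG: "verts G = verts K \<union> (\<Union>e\<in>edges K. inner_verts (P e))"
    and eG: "edges G = (\<Union>e\<in>edges K. path_edges (P e))"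
    using conjunct2[OF conjunct2[OF P']] by (rule conjunct1, rule conjunct2)
  have eK: "{u, v} \<in> edges K" if "u \<in> B" "v \<in> B" "u \<noteq> v" for u v
    using K that by (auto simp: complete_graph_def B_def)
  have eK': "\<exists>u v. e = {u, v} \<and> u \<in> B \<and> v \<in> B \<and> u \<noteq> v" if "e \<in> edges K" for e
    using K that by (auto simp: complete_graph_def B_def)
  define p where "p u v = P {u, v}" for u v
  define q where "q u v i = (if hd (p u v) = u then p u v ! i else p u v ! (m - i))" for u v i
  have p_sym: "p v u = p u v" for u v by (simp add: p_def insert_commute)
  have p: "length (p u v) = Suc m" "distinct (p u v)" "{hd (p u v), last (p u v)} = {u, v}"
      "inner_verts (p u v) = (!) (p u v) ` {0<..<m}" "inner_verts (p u v) \<inter> B = {}"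
      "hd (p u v) = p u v ! 0" "last (p u v) = p u v ! m"
    if "u \<in> B" "v \<in> B" "u \<noteq> v" for u v
  proof -
    have P': "length (p u v) = k + 2 \<and> distinct (p u v) \<and> {hd (p u v), last (p u v)} = {u, v} \<and>
        inner_verts (p u v) \<inter> verts K = {}"
      unfolding p_def by (rule P[OF eK[OF that]])
    then show l: "length (p u v) = Suc m" "distinct (p u v)" "{hd (p u v), last (p u v)} = {u, v}"
      "inner_verts (p u v) \<inter> B = {}" by (auto simp: m_def B_def)
    show "inner_verts (p u v) = (!) (p u v) ` {0<..<m}"
      unfolding m_def by (rule inner_verts_nth) (use P' in simp)
    have "p u v \<noteq> []" using l(1) by auto
    then show "hd (p u v) = p u v ! 0" "last (p u v) = p u v ! m"
      using l(1) by (simp_all add: hd_conv_nth last_conv_nth)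
  qed
  have ends: "(hd (p u v) = u \<and> last (p u v) = v) \<or> (hd (p u v) = v \<and> last (p u v) = u)"
    if "u \<in> B" "v \<in> B" "u \<noteq> v" for u v
    using p(3)[OF that] by (auto simp: doubleton_eq_iff)
  have q0: "q u v 0 = u" if "u \<in> B" "v \<in> B" "u \<noteq> v" for u v
    using ends[OF that] p(6,7)[OF that] that(3) by (auto simp: q_def)
  have qrev: "q v u i = q u v (m - i)" if "u \<in> B" "v \<in> B" "u \<noteq> v" "i \<le> m" for u v i
    using ends[OF that(1-3)] that(3,4) by (auto simp: q_def p_sym[of v u])
  have q_in: "q u v i \<in> inner_verts (p u v)" if "u \<in> B" "v \<in> B" "u \<noteq> v" "0 < i" "i < m" for u v i
    using that(4,5) unfolding p(4)[OF that(1-3)] q_def by auto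
  have qm: "q u v m = v" if "u \<in> B" "v \<in> B" "u \<noteq> v" for u v
    using qrev[of u v 0] q0[of v u] that by simp
  have inj: "x = u \<and> y = v \<and> j = i \<or> x = v \<and> y = u \<and> j = m - i"
    if uv: "u \<in> B" "v \<in> B" "u \<noteq> v" and xy: "x \<in> B" "y \<in> B" "x \<noteq> y"
      and ij: "0 < i" "i < m" "j \<le> m" and eq: "q u v i = q x y j" for u v x y i j
  proof -
    have inn: "q u v i \<in> inner_verts (p u v)" by (rule q_in[OF uv ij(1,2)])
    then have "q x y j \<notin> B" using p(5)[OF uv] eq by auto
    then have "j \<noteq> 0" "j \<noteq> m" using q0[OF xy] qm[OF xy] xy(1,2) by metis+
    then have "q x y j \<in> inner_verts (p x y)" using ij(3) by (intro q_in[OF xy]) auto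
    then have "{u, v} = {x, y}"
      using disj[OF eK[OF uv] eK[OF xy]] inn eq unfolding p_def by auto
    then consider "x = u" "y = v" | "x = v" "y = u" by (auto simp: doubleton_eq_iff)
    then have same: "q u v i = q u v (if x = u then j else m - j)"
      using eq qrev[OF uv ij(3)] uv(3) by cases auto
    have "i = l" if "q u v i = q u v l" "l \<le> m" for l
    proof -
      have "a = b" if "p u v ! a = p u v ! b" "a \<le> m" "b \<le> m" for a b
        using that p(1,2)[OF uv] by (simp add: nth_eq_iff_index_eq)
      from this[of i l] this[of "m - i" "m - l"] show ?thesis
        using that ij(2) by (auto simp: q_def split: if_splits)
    qed
    then have "i = (if x = u then j else m - j)" using same ij(3) by simp
    then show ?thesis using \<open>{u, v} = {x, y}\<close> uv(3) ij by (auto simp: doubleton_eq_iff)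
  qed
  have p_q: "p u v ! i = q u v (if hd (p u v) = u then i else m - i)" if "i \<le> m" for u v i
    using that by (simp add: q_def)
  have p_edges: "path_edges (p u v) = {{q u v i, q u v (Suc i)} |i. i < m}"
    if uv: "u \<in> B" "v \<in> B" "u \<noteq> v" for u v
  proof (cases "hd (p u v) = u")
    case True
    then show ?thesis using p(1)[OF uv] by (simp add: path_edges_def q_def)
  next
    case False
    then have nth: "p u v ! i = q u v (m - i)" if "i \<le> m" for i using p_q[OF that] by simp
    show ?thesis
    proof (intro set_eqI iffI)
      fix e assume "e \<in> path_edges (p u v)"
      then obtain i where i: "i < m" "e = {p u v ! i, p u v ! Suc i}"
        using p(1)[OF uv] by (auto simp: path_edges_def)
      then have "e = {q u v (m - Suc i), q u v (Suc (m - Suc i))}"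
        using nth by (simp add: Suc_diff_Suc insert_commute)
      then show "e \<in> {{q u v i, q u v (Suc i)} |i. i < m}" using i(1) by force
    next
      fix e assume "e \<in> {{q u v i, q u v (Suc i)} |i. i < m}"
      then obtain i where i: "i < m" "e = {q u v i, q u v (Suc i)}" by blast
      then have "e = {p u v ! (m - Suc i), p u v ! Suc (m - Suc i)}"
        using nth[of "m - i"] nth[of "m - Suc i"] by (simp add: Suc_diff_Suc insert_commute)
      then show "e \<in> path_edges (p u v)"
        using i(1) p(1)[OF uv] unfolding path_edges_def by force
    qed
  qed
  have verts: "verts G = {q u v i |u v i. u \<in> B \<and> v \<in> B \<and> u \<noteq> v \<and> i \<le> m}"
  proof (intro set_eqI iffI)
    fix x assume "x \<in> verts G"
    then consider "x \<in> B" | e where "e \<in> edges K" "x \<in> inner_verts (P e)"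
      unfolding vG B_def by blast
    then show "x \<in> {q u v i |u v i. u \<in> B \<and> v \<in> B \<and> u \<noteq> v \<and> i \<le> m}"
    proof cases
      case 1
      have "\<not> B \<subseteq> {x}"
      proof
        assume "B \<subseteq> {x}"
        then have "card B \<le> card {x}" by (intro card_mono) auto
        then show False using card by (simp add: B_def)
      qed
      then obtain w where w: "w \<in> B" "w \<noteq> x" by blast
      then have "x = q x w 0" using q0[of x w] 1 by simp
      then show ?thesis using w 1 by blast
    next
      case (2 e)
      obtain u v where uv: "e = {u, v}" "u \<in> B" "v \<in> B" "u \<noteq> v" using eK'[OF 2(1)] by blast
      then have "x \<in> inner_verts (p u v)" using 2(2) by (simp add: p_def)
      then obtain i where "i < m" "x = p u v ! i" unfolding p(4)[OF uv(2-4)] by auto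
      then have "x = q u v (if hd (p u v) = u then i else m - i)" using p_q[of i u v] by simp
      moreover have "(if hd (p u v) = u then i else m - i) \<le> m" using \<open>i < m\<close> by simp
      ultimately show ?thesis using uv(2-4) by blast
    qed
  next
    fix x assume "x \<in> {q u v i |u v i. u \<in> B \<and> v \<in> B \<and> u \<noteq> v \<and> i \<le> m}"
    then obtain u v i where x: "u \<in> B" "v \<in> B" "u \<noteq> v" "i \<le> m" "x = q u v i" by blast
    consider "i = 0" | "i = m" | "0 < i" "i < m" using x(4) by linarith
    then show "x \<in> verts G"
    proof cases
      case 3
      then have "x \<in> inner_verts (P {u, v})" using q_in[OF x(1-3)] x(5) by (simp add: p_def)
      then show ?thesis unfolding vG using eK[OF x(1-3)] by blast
    qed (use x q0[OF x(1-3)] qm[OF x(1-3)] in \<open>simp_all add: vG B_def\<close>)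
  qed
  have edges: "edges G = {{q u v i, q u v (Suc i)} |u v i. u \<in> B \<and> v \<in> B \<and> u \<noteq> v \<and> i < m}"
  proof (intro set_eqI iffI)
    fix f assume "f \<in> edges G"
    then obtain e where e: "e \<in> edges K" "f \<in> path_edges (P e)" unfolding eG by blast
    obtain u v where uv: "e = {u, v}" "u \<in> B" "v \<in> B" "u \<noteq> v" using eK'[OF e(1)] by blast
    then have "f \<in> path_edges (p u v)" using e(2) by (simp add: p_def)
    then show "f \<in> {{q u v i, q u v (Suc i)} |u v i. u \<in> B \<and> v \<in> B \<and> u \<noteq> v \<and> i < m}"
      unfolding p_edges[OF uv(2-4)] using uv(2-4) by blast
  next
    fix f assume "f \<in> {{q u v i, q u v (Suc i)} |u v i. u \<in> B \<and> v \<in> B \<and> u \<noteq> v \<and> i < m}"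
    then obtain u v i where uv: "u \<in> B" "v \<in> B" "u \<noteq> v" "i < m" "f = {q u v i, q u v (Suc i)}"
      by blast
    then have "f \<in> path_edges (p u v)" unfolding p_edges[OF uv(1-3)] by blast
    then show "f \<in> edges G" unfolding eG p_def using eK[OF uv(1-3)] by blast
  qed
  have "subdivided_clique G B m q"
  proof
    show "finite B" using K by (simp add: complete_graph_def B_def)
    show "3 \<le> card B" using card by (simp add: B_def)
    show "0 < m" by (simp add: m_def)
  qed (fact q0 qrev inj verts edges)+
  then show ?thesis unfolding B_def m_def by blast
qed

theorem mainTheorem5:
  fixes n k :: nat and K G :: "'a sgraph"
  assumes "n \<ge> 3"
    and "complete_graph K" and "card (verts K) = n"
    and "subdivision_by k K G"
  shows "tree_width G = n - 1 \<and>
    ell G = 3 * (k + 1) \<and>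
    int (connected_tree_width G) = (int n - 1) * (int k + 1) - \<lfloor>(real k + 1) / 2\<rfloor>"
proof -
  obtain q where "subdivided_clique G (verts K) (Suc k) q"
    using subdivided_clique_exists[OF assms(2) _ assms(4)] assms(1,3) by blast
  then interpret subdivided_clique G "verts K" "Suc k" q .
  have "(real k + 1) / 2 = real (Suc k) / real 2" by simp
  then have "\<lfloor>(real k + 1) / 2\<rfloor> = int (Suc k div 2)" by (simp only: floor_divide_of_nat_eq)
  moreover have "Suc k div 2 \<le> (n - 1) * Suc k"
  proof (rule order_trans)
    show "1 * Suc k \<le> (n - 1) * Suc k" using assms(1) by (intro mult_le_mono1) simp
  qed simp
  moreover have "int ((n - 1) * Suc k) = (int n - 1) * (int k + 1)"
    using assms(1) by (simp add: of_nat_diff) (simp add: algebra_simps)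
  ultimately have "int ((n - 1) * Suc k - Suc k div 2) =
      (int n - 1) * (int k + 1) - \<lfloor>(real k + 1) / 2\<rfloor>"
    by (simp only: of_nat_diff)
  then show ?thesis
    using tree_width_eq ell_eq connected_tree_width_eq assms(3) by simp
qed

end
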